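(* Let $q$ be a prime power and let $m$ be an integer with $m>2$. For each integer $r$ with $1\le r\le \delta_m:=\binom{m+2}{2}$, let $(\nu_1,\dots,\nu_{m+1})$ be the $r$th element, in descending lexicographic order, of the set $\Lambda(2,m)$ of $(m+1)$-tuples of nonnegative integers with sum $2$, and let $j:=\min\{i:\nu_i\neq 0\}$. Consider the equality $$\max_{F_1,\dots,F_r}|V(F_1,\dots,F_r)| = p_{m-2j}+\sum_{i=j}^{m}\nu_i\,(p_{m-i}-p_{m-i-j}),\qquad ( * )$$ where the maximum is over all linearly independent homogeneous polynomials $F_1,\dots,F_r$ of degree $2$ in $\mathbb{F}_q[x_0,x_1,\dots,x_m]$. Then $( * )$ does not hold in general; in fact, $( * )$ is false for at least $\binom{m-1}{2}$ values of positive integers $r$ with $m+1<r\le\delta_m$.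
   Context: $\mathbb{F}_q$ is the finite field with $q$ elements. For homogeneous $F_1,\dots,F_r\in\mathbb{F}_q[x_0,\dots,x_m]$, $V(F_1,\dots,F_r)$ is the set of points $P\in\mathbb{P}^m(\mathbb{F}_q)$ (i.e. $\mathbb{F}_q$-rational points) with $F_1(P)=\dots=F_r(P)=0$. Linear independence is over $\mathbb{F}_q$. For $j\in\mathbb{Z}$, $p_j:=|\mathbb{P}^j(\mathbb{F}_q)|=q^j+q^{j-1}+\dots+q+1$ if $j\ge 0$, and $p_j:=0$ if $j<0$. $\Lambda(2,m):=\{(\alpha_1,\dots,\alpha_{m+1})\in\mathbb{Z}^{m+1}:\alpha_1,\dots,\alpha_{m+1}\ge 0,\ \alpha_1+\dots+\alpha_{m+1}=2\}$; in descending lexicographic order its first element is $(2,0,\dots,0)$, and it has $\delta_m$ elements. $\delta_m=\binom{m+2}{2}$ is also the maximum number of linearly independent homogeneous polynomials of degree $2$ in $\mathbb{F}_q[x_0,\dots,x_m]$. An empty sum is $0$. *)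

theory Defs
  imports
    "HOL-Library.Poly_Mapping"
    "HOL-Library.List_Lexorder"
    "HOL-Library.Cardinality"
    "HOL-Library.FuncSet"
    "HOL-Number_Theory.Prime_Powers"
begin

text \<open>
  A polynomial over \<open>'k\<close> in the variables \<open>x 0, x 1, \<dots>\<close> is a finitely supported map from
  monomials (exponent vectors) to coefficients.
\<close>

type_synonym 'k mpoly = "(nat \<Rightarrow>\<^sub>0 nat) \<Rightarrow>\<^sub>0 'k"

definition mono_degree :: "(nat \<Rightarrow>\<^sub>0 nat) \<Rightarrow> nat" where
  "mono_degree t = (\<Sum>i\<in>Poly_Mapping.keys t. Poly_Mapping.lookup t i)"

text \<open>As a vector space, this contains \<open>0\<close>.\<close>

definition homogeneous :: "nat \<Rightarrow> nat \<Rightarrow> 'k::zero mpoly set" where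
  "homogeneous m d =
     {F. \<forall>t\<in>Poly_Mapping.keys F. Poly_Mapping.keys t \<subseteq> {0..m} \<and> mono_degree t = d}"

definition mpoly_eval :: "(nat \<Rightarrow> 'k) \<Rightarrow> 'k::comm_semiring_1 mpoly \<Rightarrow> 'k" where
  "mpoly_eval a F = (\<Sum>t\<in>Poly_Mapping.keys F.
     Poly_Mapping.lookup F t * (\<Prod>i\<in>Poly_Mapping.keys t. a i ^ Poly_Mapping.lookup t i))"

definition mpoly_scale :: "'k::comm_semiring_1 \<Rightarrow> 'k mpoly \<Rightarrow> 'k mpoly" where
  "mpoly_scale c F = Poly_Mapping.map ((*) c) F"

lemma lookup_mpoly_scale:
  "Poly_Mapping.lookup (mpoly_scale c F) t = c * Poly_Mapping.lookup F t"
  by (simp add: mpoly_scale_def Poly_Mapping.map.rep_eq when_def)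

interpretation mpoly: vector_space "mpoly_scale :: 'k::field \<Rightarrow> 'k mpoly \<Rightarrow> 'k mpoly"
  by unfold_locales
    (auto intro!: poly_mapping_eqI simp: lookup_mpoly_scale lookup_add algebra_simps)

text \<open>
  Homogeneous coordinates \<open>(a 0, \<dots>, a m)\<close> are functions on \<open>nat\<close> that are \<open>0\<close> beyond \<open>m\<close>;
  a point of projective space is a class of nonzero coordinate vectors modulo scaling.
\<close>

definition nonzero_vecs :: "nat \<Rightarrow> (nat \<Rightarrow> 'k::zero) set" where
  "nonzero_vecs m = {a. (\<forall>i>m. a i = 0) \<and> (\<exists>i\<le>m. a i \<noteq> 0)}"

definition proportional :: "nat \<Rightarrow> ((nat \<Rightarrow> 'k::field) \<times> (nat \<Rightarrow> 'k)) set" where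
  "proportional m = {(a, b). a \<in> nonzero_vecs m \<and> b \<in> nonzero_vecs m \<and>
     (\<exists>c. c \<noteq> 0 \<and> b = (\<lambda>i. c * a i))}"

definition proj_space :: "nat \<Rightarrow> (nat \<Rightarrow> 'k::field) set set" where
  "proj_space m = nonzero_vecs m // proportional m"

text \<open>
  For homogeneous polynomials, vanishing does not depend on the representative of a point.
\<close>

definition proj_zeros :: "nat \<Rightarrow> 'k::field mpoly set \<Rightarrow> (nat \<Rightarrow> 'k) set set" where
  "proj_zeros m S = {P \<in> proj_space m. \<forall>F\<in>S. \<forall>a\<in>P. mpoly_eval a F = 0}"

definition p_num :: "nat \<Rightarrow> int \<Rightarrow> int" where
  "p_num q j = (if j < 0 then 0 else (\<Sum>i=0..nat j. int q ^ i))"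

lemma equiv_proportional: "equiv (nonzero_vecs m) (proportional m :: ((nat \<Rightarrow> 'k::field) \<times> _) set)"
proof (rule equivI)
  show "proportional m \<subseteq> nonzero_vecs m \<times> (nonzero_vecs m :: (nat \<Rightarrow> 'k) set)"
    by (auto simp: proportional_def)
  show "refl_on (nonzero_vecs m :: (nat \<Rightarrow> 'k) set) (proportional m)"
    by (auto simp: proportional_def refl_on_def intro!: exI[of _ "1::'k"])
  show "sym (proportional m :: ((nat \<Rightarrow> 'k) \<times> _) set)"
  proof (rule symI)
    fix a b :: "nat \<Rightarrow> 'k" assume "(a, b) \<in> proportional m"
    then obtain c where "a \<in> nonzero_vecs m" "b \<in> nonzero_vecs m" "c \<noteq> 0" "b = (\<lambda>i. c * a i)"
      by (auto simp: proportional_def)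
    then show "(b, a) \<in> proportional m"
      unfolding proportional_def by (auto intro!: exI[of _ "inverse c"])
  qed
  show "trans (proportional m :: ((nat \<Rightarrow> 'k) \<times> _) set)"
  proof (rule transI)
    fix a b e :: "nat \<Rightarrow> 'k" assume "(a, b) \<in> proportional m" "(b, e) \<in> proportional m"
    then obtain c d where "a \<in> nonzero_vecs m" "e \<in> nonzero_vecs m" "c \<noteq> 0" "b = (\<lambda>i. c * a i)"
      "d \<noteq> 0" "e = (\<lambda>i. d * b i)"
      by (auto simp: proportional_def)
    then show "(a, e) \<in> proportional m"
      unfolding proportional_def by (auto intro!: exI[of _ "d * c"] simp: mult.assoc)
  qed
qed

lemma card_nonzero_vecs:
  "finite (nonzero_vecs m :: (nat \<Rightarrow> 'k::{field,finite}) set)" (is ?fin)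
  "card (nonzero_vecs m :: (nat \<Rightarrow> 'k) set) = CARD('k) ^ (m + 1) - 1" (is ?card)
proof -
  let ?E = "{0..m} \<rightarrow>\<^sub>E (UNIV :: 'k set)"
  let ?h = "\<lambda>a i. if i \<le> m then a i else (0::'k)"
  have inj: "inj_on ?h ?E"
  proof (rule inj_onI)
    fix a b assume ab: "a \<in> ?E" "b \<in> ?E" "?h a = ?h b"
    show "a = b"
    proof (rule PiE_ext[OF ab(1,2)])
      fix i assume "i \<in> {0..m}"
      then show "a i = b i" using fun_cong[OF ab(3), of i] by simp
    qed
  qed
  have img: "?h ` ?E = {a. \<forall>i>m. a i = 0}"
  proof (intro equalityI subsetI)
    fix a :: "nat \<Rightarrow> 'k" assume "a \<in> {a. \<forall>i>m. a i = 0}"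
    then have "a = ?h (restrict a {0..m})" by (auto simp: fun_eq_iff)
    then show "a \<in> ?h ` ?E" by (rule image_eqI[where x = "restrict a {0..m}"]) auto
  qed auto
  have fin: "finite {a :: nat \<Rightarrow> 'k. \<forall>i>m. a i = 0}"
    unfolding img[symmetric] by (intro finite_imageI finite_PiE) auto
  have "card {a :: nat \<Rightarrow> 'k. \<forall>i>m. a i = 0} = CARD('k) ^ (m + 1)"
    unfolding img[symmetric] using inj by (simp add: card_image card_PiE)
  moreover have "nonzero_vecs m = {a :: nat \<Rightarrow> 'k. \<forall>i>m. a i = 0} - {\<lambda>_. 0}"
    by (auto simp: nonzero_vecs_def fun_eq_iff) (meson not_le)
  ultimately show ?fin ?card using fin by (auto simp: card_Diff_singleton)
qed

lemma card_proj_space: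
  "int (card (proj_space m :: (nat \<Rightarrow> 'k::{field,finite}) set set)) = p_num CARD('k) (int m)"
proof -
  let ?q = "CARD('k)" and ?P = "proj_space m :: (nat \<Rightarrow> 'k) set set"
  have q1: "?q > 1"
    using card_mono[of UNIV "{0, 1 :: 'k}"] by simp
  have cls: "card P = ?q - 1" if P: "P \<in> ?P" for P
  proof -
    obtain a where a: "a \<in> nonzero_vecs m" and Pa: "P = proportional m `` {a}"
      using P by (auto simp: proj_space_def elim: quotientE)
    obtain k where k: "a k \<noteq> 0" using a by (auto simp: nonzero_vecs_def)
    have "P = (\<lambda>c i. c * a i) ` (UNIV - {0})"
      unfolding Pa using a by (auto simp: proportional_def nonzero_vecs_def)
    moreover have "inj_on (\<lambda>c i. c * a i) (UNIV - {0})"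
      using k by (auto intro!: inj_onI dest: fun_cong[of _ _ k])
    ultimately show ?thesis by (simp add: card_image card_Diff_singleton)
  qed
  have "(?q - 1) * card ?P = card (\<Union>?P)"
  proof (rule card_partition)
    show "finite ?P" unfolding proj_space_def
      by (rule finite_quotient[OF card_nonzero_vecs(1)]) (auto simp: proportional_def)
    show "finite (\<Union>?P)"
      unfolding proj_space_def by (simp add: Union_quotient[OF equiv_proportional] card_nonzero_vecs)
    show "\<And>c. c \<in> ?P \<Longrightarrow> card c = ?q - 1" by (rule cls)
    show "\<And>c d. c \<in> ?P \<Longrightarrow> d \<in> ?P \<Longrightarrow> c \<noteq> d \<Longrightarrow> c \<inter> d = {}"
      using quotient_disj[OF equiv_proportional] unfolding proj_space_def by blast
  qed
  also have "\<Union>?P = nonzero_vecs m"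
    unfolding proj_space_def by (rule Union_quotient[OF equiv_proportional])
  finally have "int ((?q - 1) * card ?P) = int (?q ^ (m + 1) - 1)"
    by (simp add: card_nonzero_vecs)
  then have "(int ?q - 1) * int (card ?P) = int ?q ^ (m + 1) - 1"
    using q1 by (simp add: of_nat_diff Suc_leI)
  also have "\<dots> = (int ?q - 1) * (\<Sum>i=0..m. int ?q ^ i)"
    using power_diff_1_eq[of "int ?q" "m + 1"] by (simp add: lessThan_Suc_atMost atMost_atLeast0)
  finally show ?thesis using q1 by (simp add: p_num_def)
qed

definition Lambda :: "nat \<Rightarrow> nat \<Rightarrow> nat list set" where
  "Lambda d m = {\<nu>. length \<nu> = m + 1 \<and> sum_list \<nu> = d}"

text \<open>
  The order on \<open>nat list\<close> is the lexicographic one. Lists are indexed from \<open>0\<close>, whereas \<open>r\<close>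
  and the components of \<open>\<nu>\<close> are counted from \<open>1\<close>.
\<close>

definition nth_Lambda :: "nat \<Rightarrow> nat \<Rightarrow> nat \<Rightarrow> nat list" where
  "nth_Lambda d m r = rev (sorted_list_of_set (Lambda d m)) ! (r - 1)"

definition coord :: "nat list \<Rightarrow> nat \<Rightarrow> nat" where
  "coord \<nu> i = \<nu> ! (i - 1)"

definition first_nonzero :: "nat list \<Rightarrow> nat" where
  "first_nonzero \<nu> = Min {i \<in> {1..length \<nu>}. coord \<nu> i \<noteq> 0}"

text \<open>
  If \<open>1 \<le> r \<le> (m + d) choose d\<close>, the set below is finite and nonempty, so that the maximum
  exists.
\<close>

definition max_zeros :: "'k::{field,finite} itself \<Rightarrow> nat \<Rightarrow> nat \<Rightarrow> nat \<Rightarrow> nat" where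
  "max_zeros _ d m r = Max {card (proj_zeros m (set Fs)) | Fs :: 'k mpoly list.
     length Fs = r \<and> set Fs \<subseteq> homogeneous m d \<and> distinct Fs \<and> mpoly.independent (set Fs)}"

definition conjectured_max :: "nat \<Rightarrow> nat \<Rightarrow> nat \<Rightarrow> int" where
  "conjectured_max q m r =
     (let \<nu> = nth_Lambda 2 m r; j = first_nonzero \<nu> in
       p_num q (int m - 2 * int j) +
       (\<Sum>i=j..m. int (coord \<nu> i) *
          (p_num q (int m - int i) - p_num q (int m - int i - int j))))"

end

theory Submission imports Defs "HOL-Library.Function_Algebras"
begin

text \<open>
  Write \<open>T K\<close> for \<open>Suc K choose 2\<close> and \<open>P K = pts q K\<close> for the number of points of a projective
  space of dimension \<open>K - 1\<close>. The heart of the matter is Zanella's upper bound for linear systems of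
  quadrics: if \<open>r\<close> independent quadrics in projective \<open>m\<close>-space vanish on \<open>X\<close> and
  \<open>(m + 2 choose 2) - r = T K + e\<close> with \<open>e \<le> K\<close>, then \<open>\<bar>X\<bar> \<le> P K + q ^ (e - 1)\<close>, where the last
  term is absent for \<open>e = 0\<close> (\<open>card_proj_zeros_le\<close>).

  The bound holds because few independent quadratic functions on \<open>X\<close> force few points. The proof
  (\<open>card_le_of_quadric_rank\<close>) only sees a finite set \<open>X\<close>, the space \<open>L\<close> of linear forms and a space
  \<open>Q\<close> containing all products of two linear forms. Let \<open>l\<close> be a linear form not vanishing
  identically on \<open>X\<close>, let \<open>H\<close> be its zeros in \<open>X\<close> and let \<open>s\<close> be the rank of \<open>L\<close> on \<open>X - H\<close>.
  Multiplying \<open>l\<close> by linear forms gives \<open>s\<close> independent quadratic functions that vanish on \<open>H\<close>, so the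
  rank of \<open>Q\<close> drops by at least \<open>s\<close> from \<open>X\<close> to \<open>H\<close>; and \<open>X - H\<close> lies in an affine space of dimension
  \<open>s - 1\<close>, so it has at most \<open>q ^ (s - 1)\<close> points. If \<open>s \<le> K\<close> for some \<open>l\<close>, the bound follows
  from induction on \<open>X\<close>. Otherwise all hyperplane sections have small quadric rank, hence few points by
  induction, and averaging over all hyperplanes bounds \<open>X\<close>. Throughout, dimensions of function spaces
  are read off from their cardinalities, which are powers of \<open>q\<close>.

  On the combinatorial side, put \<open>\<nu> = e\<^sub>i + e\<^sub>j\<close> with \<open>i \<le> j\<close>, where coordinates are numbered from
  \<open>0\<close>. The elements of \<open>\<Lambda>(2, m)\<close> below \<open>\<nu>\<close> number exactly \<open>T (m - i) + (m - j)\<close>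
  (\<open>card_below_exponent_list\<close>), so at the position \<open>r\<close> of \<open>\<nu>\<close> the bound applies with \<open>K = m - i\<close> and
  \<open>e = m - j\<close>. The conjectured value there is \<open>P (m - i) + P (m - j) - P (m - j - i - 1)\<close>, which
  for \<open>i \<ge> 1\<close> and \<open>j \<le> m - 2\<close> contains the two top powers \<open>q ^ (m - j - 1) + q ^ (m - j - 2)\<close> of
  \<open>P (m - j)\<close>, whereas the bound has only the first. The pairs
  \<open>1 \<le> i \<le> j \<le> m - 2\<close> number \<open>(m - 1) choose 2\<close>.
\<close>

section \<open>Counting in spaces of functions over a finite field\<close>

text \<open>
  The rank inequality in the form of cardinalities: each fibre of \<open>\<phi>\<close> contains a translate of \<open>W\<close>.
\<close>

lemma card_image_mult_le:
  fixes S W :: "'b::group_add set"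
  assumes "finite S" and inv: "\<And>s w. s \<in> S \<Longrightarrow> w \<in> W \<Longrightarrow> s + w \<in> S \<and> \<phi> (s + w) = \<phi> s"
  shows "card (\<phi> ` S) * card W \<le> card S"
proof -
  let ?g = "inv_into S \<phi>"
  have g: "?g u \<in> S" "\<phi> (?g u) = u" if "u \<in> \<phi> ` S" for u
    using that by (auto intro: inv_into_into f_inv_into_f)
  have "inj_on (\<lambda>(u, w). ?g u + w) (\<phi> ` S \<times> W)"
  proof (rule inj_onI, clarify del: imageE)
    fix u w u' w'
    assume *: "u \<in> \<phi> ` S" "w \<in> W" "u' \<in> \<phi> ` S" "w' \<in> W" "?g u + w = ?g u' + w'"
    have "u = \<phi> (?g u + w)" using *(1,2) g inv by simp
    also have "\<dots> = u'" unfolding *(5) using *(3,4) g inv by simp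
    finally show "u = u' \<and> w = w'" using *(5) by simp
  qed
  moreover have "(\<lambda>(u, w). ?g u + w) ` (\<phi> ` S \<times> W) \<subseteq> S"
    using g inv by auto
  ultimately have "card (\<phi> ` S \<times> W) \<le> card S"
    using card_inj_on_le[OF _ _ \<open>finite S\<close>] by blast
  then show ?thesis by (simp add: card_cartesian_product)
qed

definition fscale :: "'k::times \<Rightarrow> ('a \<Rightarrow> 'k) \<Rightarrow> 'a \<Rightarrow> 'k" where
  "fscale c f = (\<lambda>x. c * f x)"

lemma fscale_apply: "fscale c f x = c * f x"
  by (simp add: fscale_def)

interpretation funs: vector_space "fscale :: 'k::field \<Rightarrow> ('a \<Rightarrow> 'k) \<Rightarrow> 'a \<Rightarrow> 'k"
  by unfold_locales (auto simp: fscale_def fun_eq_iff algebra_simps)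

lemma card_field_ge_2: "CARD('k::{field,finite}) \<ge> 2"
  using card_mono[of UNIV "{0, 1 :: 'k}"] by simp

text \<open>
  Evaluation at \<open>x\<close> is a linear form on \<open>S\<close>; it is onto the field because of \<open>f\<close>, so that \<open>S\<close> is the
  direct sum of its kernel and the line through \<open>f\<close>.
\<close>

lemma card_subspace_eq_card_kernel:
  fixes S :: "('a \<Rightarrow> 'k::{field,finite}) set"
  assumes S: "funs.subspace S" and f: "f \<in> S" "f x \<noteq> 0"
  shows "card S = CARD('k) * card {g \<in> S. g x = 0}"
proof -
  let ?Z = "{g \<in> S. g x = 0}"
  have bij: "bij_betw (\<lambda>(c, g). fscale c f + g) (UNIV \<times> ?Z) S"
  proof (rule bij_betw_imageI)
    show "inj_on (\<lambda>(c, g). fscale c f + g) (UNIV \<times> ?Z)"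
    proof (rule inj_onI, clarify)
      fix c c' g g' assume *: "g x = 0" "g' x = 0" "fscale c f + g = fscale c' f + g'"
      from fun_cong[OF *(3), of x] have "c = c'" using *(1,2) f(2) by (simp add: fscale_apply)
      with * show "c = c' \<and> g = g'" by simp
    qed
    have "fscale c f + g \<in> S" if "g \<in> S" for c g
      by (intro funs.subspace_add[OF S] funs.subspace_scale[OF S] f(1) that)
    moreover have "\<exists>c. \<exists>g\<in>?Z. h = fscale c f + g" if h: "h \<in> S" for h
    proof (intro exI bexI)
      let ?c = "h x / f x"
      have "h - fscale ?c f \<in> S"
        by (intro funs.subspace_diff[OF S] funs.subspace_scale[OF S] f(1) h)
      then show "h - fscale ?c f \<in> ?Z" using f by (simp add: fscale_apply)
      show "h = fscale ?c f + (h - fscale ?c f)" by simp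
    qed
    ultimately show "(\<lambda>(c, g). fscale c f + g) ` (UNIV \<times> ?Z) = S"
      by fastforce
  qed
  from bij_betw_same_card[OF bij] show ?thesis by (simp add: card_cartesian_product)
qed

text \<open>The exponent serves as the dimension of \<open>S\<close>, without choosing bases.\<close>

lemma card_subspace_power:
  fixes S :: "('a \<Rightarrow> 'k::{field,finite}) set"
  assumes "finite S" "funs.subspace S"
  shows "\<exists>d. card S = CARD('k) ^ d"
  using assms
proof (induction S rule: finite_psubset_induct)
  case (psubset S)
  show ?case
  proof (cases "S = {0}")
    case True
    then show ?thesis by (intro exI[of _ 0]) simp
  next
    case False
    then obtain f where f: "f \<in> S" "f \<noteq> 0" using funs.subspace_0[OF psubset.prems] by blast
    then obtain x where x: "f x \<noteq> 0" by (auto simp: fun_eq_iff)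
    let ?Z = "{g \<in> S. g x = 0}"
    have "funs.subspace ?Z"
    proof (rule funs.subspaceI)
      show "0 \<in> ?Z" using funs.subspace_0[OF psubset.prems] by simp
      show "g + h \<in> ?Z" if "g \<in> ?Z" "h \<in> ?Z" for g h
        using that funs.subspace_add[OF psubset.prems] by simp
      show "fscale c g \<in> ?Z" if "g \<in> ?Z" for c g
        using that funs.subspace_scale[OF psubset.prems, of g c] by (simp add: fscale_apply)
    qed
    moreover have "?Z \<subset> S" using f x by auto
    ultimately obtain d where "card ?Z = CARD('k) ^ d" using psubset.IH by blast
    then have "card S = CARD('k) ^ Suc d"
      using card_subspace_eq_card_kernel[OF psubset.prems f(1) x] by simp
    then show ?thesis by blast
  qed
qed

text \<open>
  Extension by \<open>0\<close>, rather than by an unspecified value, makes restriction linear, so that the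
  restrictions of a subspace form a subspace of the same function type.
\<close>

definition restr :: "'a set \<Rightarrow> ('a \<Rightarrow> 'k::zero) \<Rightarrow> 'a \<Rightarrow> 'k" where
  "restr X f = (\<lambda>x. if x \<in> X then f x else 0)"

lemma restr_apply: "restr X f x = (if x \<in> X then f x else 0)"
  by (simp add: restr_def)

lemma restr_add: "restr X (f + g :: 'a \<Rightarrow> 'k::monoid_add) = restr X f + restr X g"
  by (simp add: restr_def fun_eq_iff)

lemma restr_restr: "Y \<subseteq> X \<Longrightarrow> restr Y (restr X f) = restr Y f"
  by (auto simp: restr_def fun_eq_iff)

lemma finite_restr_image:
  fixes S :: "('a \<Rightarrow> 'k::{zero,finite}) set"
  assumes "finite X"
  shows "finite (restr X ` S)"
proof (rule finite_subset)
  show "restr X ` S \<subseteq> {f. \<forall>x. (x \<in> X \<longrightarrow> f x \<in> UNIV) \<and> (x \<notin> X \<longrightarrow> f x = 0)}"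
    by (auto simp: restr_def)
  show "finite {f. \<forall>x. (x \<in> X \<longrightarrow> f x \<in> (UNIV :: 'k set)) \<and> (x \<notin> X \<longrightarrow> f x = 0)}"
    using assms by (intro finite_set_of_finite_funs) auto
qed

lemma subspace_restr_image:
  fixes S :: "('a \<Rightarrow> 'k::field) set"
  assumes "funs.subspace S"
  shows "funs.subspace (restr X ` S)"
proof (rule funs.subspaceI)
  have "restr X 0 = (0 :: 'a \<Rightarrow> 'k)" by (simp add: restr_def fun_eq_iff)
  then show "0 \<in> restr X ` S" using funs.subspace_0[OF assms] by (metis image_eqI)
  show "u + v \<in> restr X ` S" if "u \<in> restr X ` S" "v \<in> restr X ` S" for u v
    using that funs.subspace_add[OF assms] by (auto simp flip: restr_add)
  show "fscale c u \<in> restr X ` S" if u: "u \<in> restr X ` S" for c u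
  proof -
    obtain f where f: "f \<in> S" "u = restr X f" using u by blast
    then have "fscale c u = restr X (fscale c f)" by (simp add: restr_def fscale_def fun_eq_iff)
    then show ?thesis using f funs.subspace_scale[OF assms] by blast
  qed
qed

lemma card_restr_power:
  fixes S :: "('a \<Rightarrow> 'k::{field,finite}) set"
  assumes "finite X" "funs.subspace S"
  obtains d where "card (restr X ` S) = CARD('k) ^ d"
  using card_subspace_power[OF finite_restr_image subspace_restr_image] assms by blast

text \<open>
  The functions in \<open>R\<close> lie in the kernel of the restriction from \<open>X\<close> to \<open>Y\<close>.
\<close>

lemma card_restr_mult_le:
  fixes S R :: "('a \<Rightarrow> 'k::{field,finite}) set"
  assumes S: "funs.subspace S" and X: "finite X" "Y \<subseteq> X"
    and R: "R \<subseteq> S" "\<And>f y. f \<in> R \<Longrightarrow> y \<in> Y \<Longrightarrow> f y = 0"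
  shows "card (restr Y ` S) * card (restr X ` R) \<le> card (restr X ` S)"
proof -
  have "card (restr Y ` (restr X ` S)) * card (restr X ` R) \<le> card (restr X ` S)"
  proof (rule card_image_mult_le)
    fix s w assume "s \<in> restr X ` S" "w \<in> restr X ` R"
    then obtain f g where fg: "f \<in> S" "g \<in> R" "s = restr X f" "w = restr X g" by blast
    then have "s + w \<in> restr X ` S"
      using R funs.subspace_add[OF S] by (auto simp flip: restr_add)
    moreover have "restr Y (s + w) = restr Y s"
      using fg R by (auto simp: restr_def fun_eq_iff)
    ultimately show "s + w \<in> restr X ` S \<and> restr Y (s + w) = restr Y s" ..
  qed (rule finite_restr_image[OF X(1)])
  then show ?thesis using X by (simp add: image_image restr_restr)
qed

lemma card_restr_drop:
  fixes S :: "('a \<Rightarrow> 'k::{field,finite}) set"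
  assumes S: "funs.subspace S" and X: "finite X" "Y \<subseteq> X"
    and f: "f \<in> S" "\<And>y. y \<in> Y \<Longrightarrow> f y = 0" "x \<in> X" "f x \<noteq> 0"
  shows "CARD('k) * card (restr Y ` S) \<le> card (restr X ` S)"
proof -
  let ?R = "range (\<lambda>c. fscale c f)"
  have "inj (\<lambda>c. restr X (fscale c f))"
    using f by (auto intro!: injI dest!: fun_cong[of _ _ x] simp: restr_apply fscale_apply)
  then have "card (restr X ` ?R) = CARD('k)" by (simp add: image_image card_image)
  moreover have "card (restr Y ` S) * card (restr X ` ?R) \<le> card (restr X ` S)"
    using f funs.subspace_scale[OF S]
    by (intro card_restr_mult_le[OF S X]) (auto simp: fscale_apply)
  ultimately show ?thesis by (simp add: mult.commute)
qed

section \<open>Points separated by linear forms\<close>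

text \<open>
  The evaluations of \<open>L\<close> at the points of \<open>X\<close> are nonzero and pairwise not proportional, i.e. \<open>L\<close> maps
  \<open>X\<close> injectively into a projective space.
\<close>

definition separates :: "('a \<Rightarrow> 'k::field) set \<Rightarrow> 'a set \<Rightarrow> bool" where
  "separates L X \<longleftrightarrow> (\<forall>x\<in>X. \<exists>f\<in>L. f x \<noteq> 0) \<and>
     (\<forall>x\<in>X. \<forall>y\<in>X. x \<noteq> y \<longrightarrow> (\<forall>c. \<exists>f\<in>L. f x \<noteq> c * f y))"

lemma separates_subset: "separates L X \<Longrightarrow> Y \<subseteq> X \<Longrightarrow> separates L Y"
  by (auto simp: separates_def subset_iff)

text \<open>
  After division by \<open>l\<close>, the points of \<open>Y\<close> lie in an affine space whose dimension is one less than
  the rank of \<open>L\<close> on \<open>Y\<close>. A form \<open>f\<close> for which \<open>f / l\<close> is not constant on \<open>Y\<close> splits \<open>Y\<close> into one slice for each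
  value of \<open>f / l\<close>, and each slice has smaller rank, because \<open>f - c l\<close> vanishes on it but not on \<open>Y\<close>.
\<close>

lemma card_affine_le:
  fixes L :: "('a \<Rightarrow> 'k::{field,finite}) set"
  assumes L: "funs.subspace L" and l: "l \<in> L"
    and "finite Y" "separates L Y" "\<And>y. y \<in> Y \<Longrightarrow> l y \<noteq> 0"
  shows "CARD('k) * card Y \<le> card (restr Y ` L)"
  using assms(3-)
proof (induction Y rule: finite_psubset_induct)
  case (psubset Y)
  consider "Y = {}" | y where "Y = {y}" | y z where "y \<in> Y" "z \<in> Y" "y \<noteq> z" by blast
  then show ?case
  proof cases
    case 1
    then show ?thesis by simp
  next
    case 2
    have "CARD('k) * card (restr {} ` L) \<le> card (restr Y ` L)"
      using 2 psubset.prems l by (intro card_restr_drop[OF L, of _ _ l y]) auto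
    moreover have "card (restr {} ` L) > 0"
      using l finite_restr_image[of "{}" L] by (auto simp: card_gt_0_iff)
    ultimately have "CARD('k) * 1 \<le> card (restr Y ` L)"
      using mult_le_mono2[of 1 "card (restr {} ` L)" "CARD('k)"] by linarith
    then show ?thesis using 2 by simp
  next
    case 3
    obtain f where f: "f \<in> L" "f y \<noteq> l y / l z * f z" using 3 psubset.prems(1)
      unfolding separates_def by blast
    let ?Y = "\<lambda>c. {x \<in> Y. f x = c * l x}"
    have ne: "\<not> (f y = c * l y \<and> f z = c * l z)" for c
      using f(2) psubset.prems(2)[OF 3(2)] by auto
    have step: "CARD('k) * (CARD('k) * card (?Y c)) \<le> card (restr Y ` L)" for c
    proof -
      let ?g = "f - fscale c l"
      have g: "?g \<in> L" by (intro funs.subspace_diff[OF L] funs.subspace_scale[OF L] f(1) l)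
      obtain w where w: "w \<in> Y" "f w \<noteq> c * l w" using ne[of c] 3 by blast
      have "CARD('k) * card (?Y c) \<le> card (restr (?Y c) ` L)"
        using w psubset.prems by (intro psubset.IH separates_subset[OF psubset.prems(1)]) auto
      moreover have "CARD('k) * card (restr (?Y c) ` L) \<le> card (restr Y ` L)"
        using w g \<open>finite Y\<close> by (intro card_restr_drop[OF L, of _ _ ?g w]) (auto simp: fscale_apply)
      ultimately show ?thesis using le_trans mult_le_mono2 by blast
    qed
    have cover: "Y = (\<Union>c\<in>UNIV. ?Y c)"
    proof (intro equalityI subsetI)
      fix x assume "x \<in> Y"
      then show "x \<in> (\<Union>c\<in>UNIV. ?Y c)"
        using psubset.prems(2) by (auto intro!: exI[of _ "f x / l x"])
    qed auto
    have "card Y \<le> (\<Sum>c\<in>UNIV. card (?Y c))"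
      by (subst (1) cover) (rule card_UN_le[OF finite])
    then have "CARD('k) * (CARD('k) * card Y) \<le> (\<Sum>c\<in>(UNIV::'k set). CARD('k) * (CARD('k) * card (?Y c)))"
      by (simp flip: sum_distrib_left)
    also have "\<dots> \<le> (\<Sum>c\<in>(UNIV::'k set). card (restr Y ` L))" by (rule sum_mono) (rule step)
    also have "\<dots> = CARD('k) * card (restr Y ` L)" by simp
    finally show ?thesis by simp
  qed
qed

text \<open>The number of points of an \<open>(n - 1)\<close>-dimensional projective space over the field with \<open>q\<close> elements.\<close>

definition pts :: "nat \<Rightarrow> nat \<Rightarrow> nat" where
  "pts q n = (\<Sum>i<n. q ^ i)"

lemma pts_simps [simp]: "pts q 0 = 0" "pts q (Suc n) = pts q n + q ^ n"
  by (simp_all add: pts_def)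

lemma pts_mono: "a \<le> b \<Longrightarrow> pts q a \<le> pts q b"
  unfolding pts_def by (intro sum_mono2) auto

lemma pts_Suc: "pts q (Suc n) = q * pts q n + 1"
  unfolding pts_def by (subst sum.lessThan_Suc_shift) (simp add: sum_distrib_left)

lemma power_eq_pts: "q \<ge> 1 \<Longrightarrow> q ^ n = (q - 1) * pts q n + 1"
proof (induction n)
  case (Suc n)
  have "(q - 1) * pts q (Suc n) + 1 = (q - 1) * pts q n + 1 + (q - 1) * q ^ n"
    by (simp add: add_mult_distrib2)
  also have "\<dots> = q ^ n + (q - 1) * q ^ n" using Suc by simp
  also have "\<dots> = q ^ Suc n" using Suc.prems by (cases q) simp_all
  finally show ?case by simp
qed simp

text \<open>
  The hyperplane \<open>l = 0\<close> cuts a projective space into an affine space of the same dimension and a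
  projective space of dimension one less.
\<close>

lemma card_le_pts:
  fixes L :: "('a \<Rightarrow> 'k::{field,finite}) set"
  assumes L: "funs.subspace L" and "finite X" "separates L X" "card (restr X ` L) = CARD('k) ^ N"
  shows "card X \<le> pts CARD('k) N"
  using assms(2-)
proof (induction X arbitrary: N rule: finite_psubset_induct)
  case (psubset X)
  note q = card_field_ge_2[where 'k = 'k]
  show ?case
  proof (cases "X = {}")
    case False
    then obtain l x where l: "l \<in> L" "x \<in> X" "l x \<noteq> 0"
      using psubset.prems(1) False unfolding separates_def by blast
    let ?H = "{x \<in> X. l x = 0}" and ?Y = "{x \<in> X. l x \<noteq> 0}"
    have sep: "separates L ?H" "separates L ?Y"
      by (intro separates_subset[OF psubset.prems(1)]; blast)+
    obtain d where d: "card (restr ?H ` L) = CARD('k) ^ d"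
      using card_restr_power[OF _ L, of ?H] \<open>finite X\<close> by auto
    have "CARD('k) * card (restr ?H ` L) \<le> card (restr X ` L)"
      using l \<open>finite X\<close> by (intro card_restr_drop[OF L, of _ _ l x]) auto
    then have "CARD('k) ^ Suc d \<le> CARD('k) ^ N"
      unfolding d psubset.prems by simp
    then have dN: "Suc d \<le> N" using q by (subst (asm) power_increasing_iff) auto
    then obtain n where n: "N = Suc n" "d \<le> n" by (cases N) auto
    have "card ?H \<le> pts CARD('k) d" using l d by (intro psubset.IH sep) auto
    also have "\<dots> \<le> pts CARD('k) n" using n by (intro pts_mono)
    finally have H: "card ?H \<le> pts CARD('k) n" .
    have "CARD('k) * card ?Y \<le> card (restr ?Y ` L)"
      using \<open>finite X\<close> by (intro card_affine_le[OF L l(1)] sep) auto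
    also have "\<dots> \<le> card (restr X ` L)"
    proof (rule surj_card_le)
      show "finite (restr X ` L)" using \<open>finite X\<close> by (rule finite_restr_image)
      show "restr ?Y ` L \<subseteq> restr ?Y ` (restr X ` L)"
        by (simp add: image_image restr_restr)
    qed
    finally have "card ?Y \<le> CARD('k) ^ n" using q by (simp add: psubset.prems n)
    moreover have "card X = card ?H + card ?Y"
      using \<open>finite X\<close> by (subst card_Un_disjoint[symmetric]) (auto intro!: arg_cong[where f = card])
    ultimately show ?thesis using H by (simp add: n)
  qed simp
qed

section \<open>A bound from the number of independent quadrics\<close>

text \<open>Convexity: with a fixed sum of exponents, the sum of two powers grows as the exponents move apart.\<close>

lemma power_add_power_le:
  fixes q :: nat
  assumes "q \<ge> 1" "c \<le> a" "c \<le> b"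
  shows "q ^ a + q ^ b \<le> q ^ c + q ^ (a + b - c)"
proof -
  obtain u v where uv: "a = c + u" "b = c + v" using assms le_Suc_ex by metis
  obtain x y where xy: "q ^ u = Suc x" "q ^ v = Suc y"
    using \<open>q \<ge> 1\<close> by (metis One_nat_def Suc_le_D one_le_power)
  have "q ^ u + q ^ v \<le> 1 + q ^ u * q ^ v" unfolding xy by simp
  then have "q ^ c * (q ^ u + q ^ v) \<le> q ^ c * (1 + q ^ u * q ^ v)" by (rule mult_le_mono2)
  then show ?thesis by (simp add: uv power_add algebra_simps)
qed

lemma power_add_power_le_power:
  fixes q :: nat
  assumes "q \<ge> 2"
  shows "q ^ a + q ^ b \<le> q ^ (a + b + 1)"
proof -
  have "q ^ a + q ^ b \<le> 1 + q ^ (a + b)" using power_add_power_le[of q 0 a b] assms by simp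
  also have "\<dots> \<le> 2 * q ^ (a + b)" using assms by simp
  also have "\<dots> \<le> q * q ^ (a + b)" using assms by (intro mult_le_mono1)
  finally show ?thesis by simp
qed

text \<open>
  The quadratic functions \<open>l f\<close> with \<open>f \<in> L\<close> vanish on the zeros of \<open>l\<close>. On \<open>X\<close> they determine, and are
  determined by, the values of \<open>f\<close> off the zeros of \<open>l\<close>.
\<close>

lemma card_restr_split:
  fixes L Q :: "('a \<Rightarrow> 'k::{field,finite}) set"
  assumes Q: "funs.subspace Q" and LQ: "\<And>f g. f \<in> L \<Longrightarrow> g \<in> L \<Longrightarrow> f * g \<in> Q"
    and X: "finite X" and l: "l \<in> L"
  shows "card (restr {x \<in> X. l x = 0} ` Q) * card (restr {x \<in> X. l x \<noteq> 0} ` L)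
    \<le> card (restr X ` Q)"
proof -
  let ?Y = "{x \<in> X. l x \<noteq> 0}" and ?R = "(*) l ` L"
  have "restr X ` ?R = (*) l ` (restr ?Y ` L)"
    unfolding image_image by (intro image_cong) (auto simp: restr_def fun_eq_iff)
  moreover have "inj_on ((*) l) (restr ?Y ` L)"
  proof (rule inj_onI, clarify)
    fix f g assume eq: "l * restr ?Y f = l * restr ?Y g"
    show "restr ?Y f = restr ?Y g"
    proof
      fix x show "restr ?Y f x = restr ?Y g x"
        using fun_cong[OF eq, of x] by (auto simp: restr_apply)
    qed
  qed
  ultimately have "card (restr X ` ?R) = card (restr ?Y ` L)" by (simp add: card_image)
  moreover have "card (restr {x \<in> X. l x = 0} ` Q) * card (restr X ` ?R) \<le> card (restr X ` Q)"
    using l LQ by (intro card_restr_mult_le[OF Q X]) auto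
  ultimately show ?thesis by simp
qed

text \<open>
  Averaging over hyperplanes, as a double count of the pairs \<open>(x, f)\<close> with \<open>f x = 0\<close>, where \<open>f\<close> runs over
  the restrictions of \<open>L\<close> to \<open>X\<close>. The summand \<open>card X\<close> on the right comes from \<open>f = 0\<close>.
\<close>

lemma card_le_if_sections_le:
  fixes L :: "('a \<Rightarrow> 'k::{field,finite}) set"
  assumes L: "funs.subspace L" and X: "finite X" and sep: "separates L X"
    and N: "card (restr X ` L) = CARD('k) ^ Suc n"
    and B: "\<And>l x. l \<in> L \<Longrightarrow> x \<in> X \<Longrightarrow> l x \<noteq> 0 \<Longrightarrow> card {y \<in> X. l y = 0} \<le> B"
  shows "card X * CARD('k) ^ n \<le> card X + (CARD('k) ^ Suc n - 1) * B"
proof -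
  let ?F = "restr X ` L"
  note F = finite_restr_image[OF X, of L] subspace_restr_image[OF L, of X]
  have fib: "card {f \<in> ?F. f x = 0} = CARD('k) ^ n" if x: "x \<in> X" for x
  proof -
    obtain l where "l \<in> L" "l x \<noteq> 0" using sep x unfolding separates_def by blast
    then have "restr X l \<in> ?F" "restr X l x \<noteq> 0" using x by (auto simp: restr_apply)
    from card_subspace_eq_card_kernel[OF F(2) this] N show ?thesis by simp
  qed
  have "card X * CARD('k) ^ n = (\<Sum>x\<in>X. card {f \<in> ?F. f x = 0})" by (simp add: fib)
  also have "\<dots> = (\<Sum>f\<in>?F. card {x \<in> X. f x = 0})"
    by (rule sum_multicount_gen[OF X F(1)]) simp
  also have "\<dots> = card {x \<in> X. (0 :: 'a \<Rightarrow> 'k) x = 0} + (\<Sum>f\<in>?F - {0}. card {x \<in> X. f x = 0})"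
    by (rule sum.remove[OF F(1) funs.subspace_0[OF F(2)]])
  also have "\<dots> \<le> card X + (\<Sum>f\<in>?F - {0}. B)"
  proof (intro add_mono sum_mono)
    fix f assume "f \<in> ?F - {0}"
    then obtain l where l: "l \<in> L" "f = restr X l" "restr X l \<noteq> 0" by blast
    then obtain x where "x \<in> X" "l x \<noteq> 0"
      by (auto simp: restr_def fun_eq_iff split: if_splits)
    then have "card {y \<in> X. l y = 0} \<le> B" using B l by blast
    moreover have "{y \<in> X. f y = 0} = {y \<in> X. l y = 0}" using l by (auto simp: restr_apply)
    ultimately show "card {x \<in> X. f x = 0} \<le> B" by simp
  qed simp
  also have "(\<Sum>f\<in>?F - {0}. B) = (CARD('k) ^ Suc n - 1) * B"
    using F funs.subspace_0[OF F(2)] N by (simp add: card_Diff_singleton)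
  finally show ?thesis .
qed

text \<open>
  For the quadrics of a projective space and \<open>e \<ge> 1\<close>, equality holds when \<open>X\<close> is the union of two
  subspaces with \<open>pts q K\<close> and \<open>pts q e\<close> points, where the first meets the second in a hyperplane of the second.
\<close>

proposition card_le_of_quadric_rank:
  fixes L Q :: "('a \<Rightarrow> 'k::{field,finite}) set"
  defines "q \<equiv> CARD('k)"
  assumes L: "funs.subspace L" and Q: "funs.subspace Q"
    and LQ: "\<And>f g. f \<in> L \<Longrightarrow> g \<in> L \<Longrightarrow> f * g \<in> Q"
    and "finite X" "separates L X"
    and "card (restr X ` Q) \<le> q ^ ((Suc K choose 2) + e)" "e \<le> K"
  shows "card X \<le> pts q K + (if e = 0 then 0 else q ^ (e - 1))"
  using assms(5-)
proof (induction X arbitrary: K e rule: finite_psubset_induct)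
  case (psubset X)
  have q: "q \<ge> 2" unfolding q_def by (rule card_field_ge_2)
  obtain h where h: "card (restr X ` Q) = q ^ h"
    using card_restr_power[OF \<open>finite X\<close> Q] q_def by blast
  have hle: "h \<le> (Suc K choose 2) + e"
    using psubset.prems(2) q unfolding h by (subst (asm) power_increasing_iff) auto
  \<comment> \<open>\<open>s\<close> is the rank of \<open>L\<close> off the hyperplane \<open>l = 0\<close>, and \<open>d\<close> is the rank of \<open>Q\<close> on it.\<close>
  have cut: "\<exists>s d. card (restr {y \<in> X. l y = 0} ` Q) = q ^ d \<and> d + s \<le> h \<and> 1 \<le> s \<and>
      card X \<le> card {y \<in> X. l y = 0} + q ^ (s - 1)"
    if l: "l \<in> L" and x: "x \<in> X" "l x \<noteq> 0" for l x
  proof -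
    let ?H = "{y \<in> X. l y = 0}" and ?Y = "{y \<in> X. l y \<noteq> 0}"
    obtain d where d: "card (restr ?H ` Q) = q ^ d"
      using card_restr_power[OF _ Q, of ?H] \<open>finite X\<close> by (auto simp: q_def)
    obtain s where s: "card (restr ?Y ` L) = q ^ s"
      using card_restr_power[OF _ L, of ?Y] \<open>finite X\<close> by (auto simp: q_def)
    have "q ^ (d + s) \<le> q ^ h"
      using card_restr_split[OF Q LQ \<open>finite X\<close> l] by (simp add: d s h power_add)
    then have "d + s \<le> h" using q by (subst (asm) power_increasing_iff) auto
    have "CARD('k) * card ?Y \<le> card (restr ?Y ` L)"
      using \<open>finite X\<close>
      by (intro card_affine_le[OF L l] separates_subset[OF psubset.prems(1)]) auto
    then have Yle: "q * card ?Y \<le> q ^ s" by (simp add: s flip: q_def)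
    have "?Y \<noteq> {}" "finite ?Y" using x \<open>finite X\<close> by auto
    then have "card ?Y \<ge> 1" by (simp add: Suc_le_eq card_gt_0_iff)
    then have "q * 1 \<le> q ^ s" using Yle mult_le_mono2 le_trans by blast
    then have "s \<noteq> 0" using q by (cases s) auto
    then obtain t where t: "s = Suc t" by (cases s) auto
    then have "card ?Y \<le> q ^ (s - 1)" using Yle q by simp
    moreover have "card X = card ?H + card ?Y"
      using \<open>finite X\<close> by (subst card_Un_disjoint[symmetric]) (auto intro!: arg_cong[where f = card])
    ultimately show ?thesis
      using d \<open>d + s \<le> h\<close> t by (intro exI[of _ s] exI[of _ d]) simp
  qed
  have IH: "card {y \<in> X. l y = 0} \<le> pts q K' + (if e' = 0 then 0 else q ^ (e' - 1))"
    if "x \<in> X" "l x \<noteq> 0" "card (restr {y \<in> X. l y = 0} ` Q) = q ^ d"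
      "d \<le> (Suc K' choose 2) + e'" "e' \<le> K'" for l x d K' e'
  proof (rule psubset.IH)
    show "{y \<in> X. l y = 0} \<subset> X" using that by auto
    show "separates L {y \<in> X. l y = 0}" by (rule separates_subset[OF psubset.prems(1)]) auto
    show "card (restr {y \<in> X. l y = 0} ` Q) \<le> q ^ ((Suc K' choose 2) + e')"
      unfolding that using that q by (intro power_increasing) auto
  qed fact
  obtain N where N: "card (restr X ` L) = q ^ N"
    using card_restr_power[OF \<open>finite X\<close> L] q_def by blast
  consider "N \<le> K" | "X = {}" | "X \<noteq> {}" "K < N" by linarith
  then show ?case
  proof cases
    case 1
    have "card X \<le> pts q N"
      using card_le_pts[OF L \<open>finite X\<close> psubset.prems(1)] N by (simp add: q_def)
    also have "\<dots> \<le> pts q K" using 1 by (rule pts_mono)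
    finally show ?thesis by simp
  next
    case 3
    then obtain l0 x0 where l0: "l0 \<in> L" "x0 \<in> X" "l0 x0 \<noteq> 0"
      using psubset.prems(1) unfolding separates_def by blast
    obtain k where k: "K = Suc k"
    proof (cases K)
      case 0
      then have "h = 0" using hle \<open>e \<le> K\<close> by (simp add: binomial_eq_0)
      then show ?thesis using cut[OF l0] by auto
    qed
    \<comment> \<open>A rank of \<open>T K + e - s\<close> with \<open>e < s\<close> is to be read as \<open>T k\<close> plus a remainder.\<close>
    have T: "Suc K choose 2 = (Suc k choose 2) + Suc k"
      by (simp add: k numeral_2_eq_2)
    show ?thesis
    proof (cases "\<exists>l\<in>L. \<exists>x\<in>X. \<exists>s d. l x \<noteq> 0 \<and> card (restr {y \<in> X. l y = 0} ` Q) = q ^ d \<and>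
        d + s \<le> h \<and> 1 \<le> s \<and> s \<le> K \<and> card X \<le> card {y \<in> X. l y = 0} + q ^ (s - 1)")
      case True
      then obtain l x s d where l: "l \<in> L" "x \<in> X" "l x \<noteq> 0"
        and d: "card (restr {y \<in> X. l y = 0} ` Q) = q ^ d" "d + s \<le> h"
        and s: "1 \<le> s" "s \<le> K" and X: "card X \<le> card {y \<in> X. l y = 0} + q ^ (s - 1)" by blast
      show ?thesis
      proof (cases "s \<le> e")
        case True
        have "card {y \<in> X. l y = 0} \<le> pts q K + (if e - s = 0 then 0 else q ^ (e - s - 1))"
          using True d hle \<open>e \<le> K\<close> by (intro IH[OF l(2,3) d(1)]) auto
        moreover have "(if e - s = 0 then 0 else q ^ (e - s - 1)) + q ^ (s - 1) \<le> q ^ (e - 1)"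
        proof (cases "e = s")
          case False
          have sum: "e - s - 1 + (s - 1) + 1 = e - 1" using False True s by simp
          show ?thesis
            using power_add_power_le_power[OF q, of "e - s - 1" "s - 1", unfolded sum] False True by simp
        qed simp
        ultimately show ?thesis using X True s by simp
      next
        case False
        have "card {y \<in> X. l y = 0} \<le>
            pts q k + (if K + e - s = 0 then 0 else q ^ (K + e - s - 1))"
          using False d hle s k T by (intro IH[OF l(2,3) d(1)]) auto
        moreover have "(if K + e - s = 0 then 0 else q ^ (K + e - s - 1)) + q ^ (s - 1)
            \<le> q ^ k + (if e = 0 then 0 else q ^ (e - 1))"
        proof -
          consider "e = 0" "s = K" | "e = 0" "s < K" | "e \<ge> 1" using s by linarith
          then show ?thesis
          proof cases
            case 1
            then show ?thesis by (simp add: k)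
          next
            case 2
            then have sum: "K - s - 1 + (s - 1) + 1 = k" using s k by simp
            show ?thesis
              using power_add_power_le_power[OF q, of "K - s - 1" "s - 1", unfolded sum] 2 by simp
          next
            case 3
            have "K + e - s - 1 + (s - 1) - (e - 1) = k" "e - 1 \<le> K + e - s - 1" "e - 1 \<le> s - 1"
              using 3 s False k by simp_all
            then show ?thesis
              using power_add_power_le[of q "e - 1" "K + e - s - 1" "s - 1"] 3 s q False by simp
          qed
        qed
        ultimately show ?thesis using X by (simp add: k)
      qed
    next
      case False
      \<comment> \<open>Now each section has rank at most \<open>T K + e - (K + 1)\<close>, which is \<open>T k + (e - 1)\<close> for \<open>e > 0\<close>
        and less than \<open>T k\<close> for \<open>e = 0\<close>; truncated subtraction lets one formula serve for both.\<close>
      define B where "B = pts q k + (if e - 1 = 0 then 0 else q ^ (e - 1 - 1))"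
      have B: "card {y \<in> X. l y = 0} \<le> B" if l: "l \<in> L" "x \<in> X" "l x \<noteq> 0" for l x
      proof -
        from cut[OF l] obtain s d where sd: "card (restr {y \<in> X. l y = 0} ` Q) = q ^ d"
          "d + s \<le> h" "1 \<le> s" "card X \<le> card {y \<in> X. l y = 0} + q ^ (s - 1)" by blast
        then have "s > K" using False l by (meson not_le)
        then show ?thesis
          unfolding B_def using sd T hle k \<open>e \<le> K\<close> by (intro IH[OF l(2,3) sd(1)]) auto
      qed
      show ?thesis
      proof (rule ccontr)
        assume neg: "\<not> ?thesis"
        obtain n where n: "N = Suc n" using 3(2) by (cases N) auto
        have main: "card X * q ^ n \<le> card X + (q ^ Suc n - 1) * B"
          using card_le_if_sections_le[OF L \<open>finite X\<close> psubset.prems(1)] B N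
          unfolding q_def n by blast
        obtain M where M: "q ^ n = Suc M" using q by (cases "q ^ n") auto
        obtain p where p: "q = Suc p" "p \<ge> 1" using q by (cases q) auto
        \<comment> \<open>If the bound failed, \<open>card X\<close> would exceed \<open>q B\<close>, its approximate average value, by at least
          \<open>2\<close>. The double count leaves room for an excess of \<open>(q - 1) B / M\<close> only, which is below \<open>2\<close>.\<close>
        have qB: "q * B + 2 \<le> card X"
        proof -
          have "q * B = q * pts q k + (if e \<le> 1 then 0 else q ^ (e - 1))"
            by (cases e; cases "e - 1") (auto simp: B_def algebra_simps)
          moreover have "q * pts q k + 1 = pts q K" by (simp only: k pts_Suc)
          ultimately show ?thesis using neg by (auto split: if_splits)
        qed
        have "q ^ Suc n = q * M + Suc p" 
          by (subst p(1)[symmetric]) (simp only: power_Suc M mult_Suc_right add.commute)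
        then have "q ^ Suc n - 1 = q * M + p" by simp
        then have "card X * M \<le> (q * M + p) * B" using main by (simp add: M)
        moreover have "(q * B + 2) * M \<le> card X * M" using qB by (rule mult_le_mono1)
        ultimately have "2 * M \<le> p * B" by (simp add: algebra_simps)
        moreover have "p * pts q K \<le> M"
        proof -
          have "p * pts q K + 1 = q ^ K" using power_eq_pts[of q K] q p by simp
          also have "\<dots> \<le> q ^ n" using 3(2) n q by (intro power_increasing) auto
          finally show ?thesis by (simp add: M)
        qed
        ultimately have "p * (2 * pts q K) \<le> p * B" by linarith
        then have "2 * pts q K \<le> B" using p by simp
        moreover have "B \<le> pts q K"
          using q \<open>e \<le> K\<close> unfolding B_def k by (auto intro!: power_increasing)
        moreover have "pts q K \<ge> 1" using q by (simp add: k Suc_le_eq)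
        ultimately show False by simp
      qed
    qed
  qed simp
qed

section \<open>Monomials of degree two\<close>

text \<open>
  The exponent vector of the monomial \<open>x\<^sub>i x\<^sub>j\<close>; it has a \<open>2\<close> at \<open>i\<close> if \<open>i = j\<close>.
\<close>

definition pair_mult :: "nat \<Rightarrow> nat \<Rightarrow> nat \<Rightarrow> nat" where
  "pair_mult i j k = of_bool (k = i) + of_bool (k = j)"

definition pairs :: "nat \<Rightarrow> (nat \<times> nat) set" where
  "pairs m = {(i, j). i \<le> j \<and> j \<le> m}"

lemma finite_pairs: "finite (pairs m)"
  by (rule finite_subset[of _ "{..m} \<times> {..m}"]) (auto simp: pairs_def)

lemma card_pairs_from:
  "n \<le> Suc m \<Longrightarrow> card {(i, j). n \<le> i \<and> i \<le> j \<and> j \<le> m} = Suc (Suc m - n) choose 2"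
proof (induction n rule: inc_induct)
  case base
  have "{(i, j). Suc m \<le> i \<and> i \<le> j \<and> j \<le> m} = {}" by auto
  then show ?case by (simp only: card.empty) (simp add: binomial_eq_0)
next
  case (step n)
  let ?P = "\<lambda>n. {(i, j). n \<le> i \<and> i \<le> j \<and> j \<le> m}"
  have "finite (?P (Suc n))"
    by (rule finite_subset[of _ "{..m} \<times> {..m}"]) auto
  moreover have "?P n = {n} \<times> {n..m} \<union> ?P (Suc n)" by auto
  ultimately have "card (?P n) = card ({n} \<times> {n..m}) + card (?P (Suc n))"
    by (simp add: card_Un_disjoint disjoint_iff)
  also have "\<dots> = (Suc m - n) + (Suc (Suc m - Suc n) choose 2)"
    unfolding step.IH by (simp add: card_cartesian_product)
  also have "\<dots> = Suc (Suc m - n) choose 2"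
    using step.hyps by (simp add: Suc_diff_le numeral_2_eq_2)
  finally show ?case .
qed

lemma card_pairs: "card (pairs m) = (m + 2) choose 2"
  using card_pairs_from[of 0 m] by (simp add: pairs_def)

lemma pair_mult_inj:
  assumes "(i, j) \<in> pairs m" "(i', j') \<in> pairs m"
    and eq: "\<And>k. k \<le> m \<Longrightarrow> pair_mult i j k = pair_mult i' j' k"
  shows "i = i' \<and> j = j'"
proof -
  have le: "i \<le> j" "j \<le> m" "i' \<le> j'" "j' \<le> m" using assms(1,2) by (auto simp: pairs_def)
  have "i = i' \<or> i = j'" using eq[of i] le
    by (cases "i = i'"; cases "i = j'") (simp_all add: pair_mult_def)
  moreover have "i' = i \<or> i' = j" using eq[of i'] le
    by (cases "i' = i"; cases "i' = j") (simp_all add: pair_mult_def)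
  ultimately have i: "i = i'" using le by linarith
  with eq[of j] le have "j = j'" by (cases "j = j'") (simp_all add: pair_mult_def)
  with i show ?thesis by simp
qed

lemma sum_eq_Suc_decomp:
  fixes f :: "nat \<Rightarrow> nat"
  assumes "(\<Sum>k\<le>m. f k) = Suc n"
  obtains i g where "i \<le> m" "(\<Sum>k\<le>m. g k) = n" "\<And>k. f k = g k + of_bool (k = i)"
proof -
  have "\<exists>i\<le>m. f i \<noteq> 0"
  proof (rule ccontr)
    assume "\<not> ?thesis"
    then have "(\<Sum>k\<le>m. f k) = 0" by simp
    with assms show False by simp
  qed
  then obtain i where i: "i \<le> m" "f i \<noteq> 0" by blast
  define g where "g = f(i := f i - 1)"
  have f: "f k = g k + of_bool (k = i)" for k using i by (simp add: g_def)
  have "(\<Sum>k\<le>m. f k) = (\<Sum>k\<le>m. g k) + (\<Sum>k\<le>m. of_bool (k = i))"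
    by (simp add: f sum.distrib)
  moreover have "(\<Sum>k\<le>m. of_bool (k = i)) = (1 :: nat)" using i by (simp add: of_bool_def)
  ultimately show ?thesis using assms that i f by simp
qed

text \<open>
  Both monomials of degree two and elements of \<open>\<Lambda>(2, m)\<close> are sequences of this kind, so that this
  classification serves for either.
\<close>

lemma sum_eq_2_decomp:
  fixes f :: "nat \<Rightarrow> nat"
  assumes "(\<Sum>k\<le>m. f k) = 2"
  obtains i j where "(i, j) \<in> pairs m" "\<And>k. k \<le> m \<Longrightarrow> f k = pair_mult i j k"
proof -
  obtain i g where g: "i \<le> m" "(\<Sum>k\<le>m. g k) = 1" "\<And>k. f k = g k + of_bool (k = i)"
    using sum_eq_Suc_decomp[of f m 1] assms by (metis Suc_1)
  obtain j h where h: "j \<le> m" "(\<Sum>k\<le>m. h k) = 0" "\<And>k. g k = h k + of_bool (k = j)"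
    using sum_eq_Suc_decomp[of g m 0] g(2) by (metis One_nat_def)
  have "f k = pair_mult (min i j) (max i j) k" if "k \<le> m" for k
    using g h that by (auto simp: pair_mult_def min_def max_def)
  moreover have "(min i j, max i j) \<in> pairs m" using g h by (auto simp: pairs_def)
  ultimately show ?thesis using that by blast
qed

lemma sum_pair_mult: "(i, j) \<in> pairs m \<Longrightarrow> (\<Sum>k\<le>m. pair_mult i j k) = 2"
  by (auto simp: pair_mult_def pairs_def sum.distrib of_bool_def)

section \<open>Quadratic forms as functions\<close>

definition mono_val :: "(nat \<Rightarrow> 'k::comm_semiring_1) \<Rightarrow> (nat \<Rightarrow>\<^sub>0 nat) \<Rightarrow> 'k" where
  "mono_val a t = (\<Prod>i\<in>Poly_Mapping.keys t. a i ^ Poly_Mapping.lookup t i)"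

lemma mono_val_superset:
  "finite A \<Longrightarrow> Poly_Mapping.keys t \<subseteq> A \<Longrightarrow> mono_val a t = (\<Prod>i\<in>A. a i ^ Poly_Mapping.lookup t i)"
  unfolding mono_val_def by (intro prod.mono_neutral_left) (auto simp: in_keys_iff)

lemma mono_degree_superset:
  "finite A \<Longrightarrow> Poly_Mapping.keys t \<subseteq> A \<Longrightarrow> mono_degree t = (\<Sum>i\<in>A. Poly_Mapping.lookup t i)"
  unfolding mono_degree_def by (intro sum.mono_neutral_left) (auto simp: in_keys_iff)

lemma mpoly_eval_superset:
  "finite A \<Longrightarrow> Poly_Mapping.keys F \<subseteq> A \<Longrightarrow>
    mpoly_eval a F = (\<Sum>t\<in>A. Poly_Mapping.lookup F t * mono_val a t)"
  unfolding mpoly_eval_def mono_val_def by (intro sum.mono_neutral_left) (auto simp: in_keys_iff)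

lemma mpoly_eval_add: "mpoly_eval a (F + G) = mpoly_eval a F + mpoly_eval a G"
proof -
  let ?A = "Poly_Mapping.keys F \<union> Poly_Mapping.keys G"
  have "mpoly_eval a H = (\<Sum>t\<in>?A. Poly_Mapping.lookup H t * mono_val a t)"
    if "Poly_Mapping.keys H \<subseteq> ?A" for H
    using that by (intro mpoly_eval_superset) auto
  then show ?thesis
    using keys_add[of F G] by (simp add: lookup_add distrib_right sum.distrib)
qed

lemma keys_mpoly_scale: "Poly_Mapping.keys (mpoly_scale c F) \<subseteq> Poly_Mapping.keys F"
  by (auto simp: in_keys_iff lookup_mpoly_scale)

lemma mpoly_eval_scale: "mpoly_eval a (mpoly_scale c F) = c * mpoly_eval a F"
  using mpoly_eval_superset[OF finite_keys keys_mpoly_scale, of a c F]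
    mpoly_eval_superset[OF finite_keys order_refl, of a F]
  by (simp add: lookup_mpoly_scale sum_distrib_left mult.assoc)

lemma subspace_homogeneous: "mpoly.subspace (homogeneous m d :: 'k::field mpoly set)"
proof (rule mpoly.subspaceI)
  show "F + G \<in> homogeneous m d" if "F \<in> homogeneous m d" "G \<in> homogeneous m d"
    for F G :: "'k mpoly"
    using that keys_add[of F G] unfolding homogeneous_def by blast
  show "mpoly_scale c F \<in> homogeneous m d" if "F \<in> homogeneous m d" for c and F :: "'k mpoly"
    using that keys_mpoly_scale[of c F] unfolding homogeneous_def by blast
qed (simp add: homogeneous_def)

definition quadric_monomials :: "nat \<Rightarrow> (nat \<Rightarrow>\<^sub>0 nat) set" where
  "quadric_monomials m = {t. Poly_Mapping.keys t \<subseteq> {0..m} \<and> mono_degree t = 2}"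

definition pair_monomial :: "nat \<Rightarrow> nat \<Rightarrow> nat \<Rightarrow>\<^sub>0 nat" where
  "pair_monomial i j = Poly_Mapping.single i 1 + Poly_Mapping.single j 1"

lemma lookup_pair_monomial: "Poly_Mapping.lookup (pair_monomial i j) k = pair_mult i j k"
  by (auto simp: pair_monomial_def lookup_add lookup_single pair_mult_def when_def)

lemma keys_pair_monomial: "Poly_Mapping.keys (pair_monomial i j) = {i, j}"
  by (auto simp: in_keys_iff lookup_pair_monomial pair_mult_def)

lemma mono_val_pair_monomial: "mono_val a (pair_monomial i j) = a i * a j"
  by (cases "i = j")
    (simp_all add: mono_val_def keys_pair_monomial lookup_pair_monomial pair_mult_def power2_eq_square)

lemma pair_monomial_commute: "pair_monomial i j = pair_monomial j i"
  by (simp add: pair_monomial_def add.commute)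

lemma bij_betw_pair_monomial:
  "bij_betw (\<lambda>(i, j). pair_monomial i j) (pairs m) (quadric_monomials m)"
proof (rule bij_betw_imageI)
  show "inj_on (\<lambda>(i, j). pair_monomial i j) (pairs m)"
  proof (rule inj_onI, clarify)
    fix i j i' j' assume *: "(i, j) \<in> pairs m" "(i', j') \<in> pairs m"
      "pair_monomial i j = pair_monomial i' j'"
    then show "i = i' \<and> j = j'" using pair_mult_inj lookup_pair_monomial by metis
  qed
  show "(\<lambda>(i, j). pair_monomial i j) ` pairs m = quadric_monomials m"
  proof (intro equalityI subsetI)
    fix t assume "t \<in> (\<lambda>(i, j). pair_monomial i j) ` pairs m"
    then obtain i j where ij: "(i, j) \<in> pairs m" "t = pair_monomial i j" by auto
    then have keys: "Poly_Mapping.keys t \<subseteq> {0..m}" by (auto simp: keys_pair_monomial pairs_def)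
    then have "mono_degree t = 2"
      using ij sum_pair_mult[OF ij(1)]
      by (subst mono_degree_superset[of "{..m}"]) (auto simp: lookup_pair_monomial)
    with keys show "t \<in> quadric_monomials m" by (simp add: quadric_monomials_def)
  next
    fix t assume t: "t \<in> quadric_monomials m"
    then have keys: "Poly_Mapping.keys t \<subseteq> {..m}" by (auto simp: quadric_monomials_def)
    then have "(\<Sum>k\<le>m. Poly_Mapping.lookup t k) = 2"
      using t mono_degree_superset[of "{..m}" t] by (simp add: quadric_monomials_def)
    then obtain i j where ij: "(i, j) \<in> pairs m"
      "\<And>k. k \<le> m \<Longrightarrow> Poly_Mapping.lookup t k = pair_mult i j k" by (rule sum_eq_2_decomp) blast
    have "t = pair_monomial i j"
    proof (rule poly_mapping_eqI)
      fix k show "Poly_Mapping.lookup t k = Poly_Mapping.lookup (pair_monomial i j) k"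
      proof (cases "k \<le> m")
        case False
        then have "k \<notin> Poly_Mapping.keys t" "k \<noteq> i" "k \<noteq> j" using keys ij by (auto simp: pairs_def)
        then show ?thesis by (simp add: in_keys_iff lookup_pair_monomial pair_mult_def)
      qed (simp add: ij lookup_pair_monomial)
    qed
    then show "t \<in> (\<lambda>(i, j). pair_monomial i j) ` pairs m" using ij by auto
  qed
qed

lemma finite_quadric_monomials: "finite (quadric_monomials m)"
  using bij_betw_finite[OF bij_betw_pair_monomial] finite_pairs by blast

lemma card_quadric_monomials: "card (quadric_monomials m) = (m + 2) choose 2"
  using bij_betw_same_card[OF bij_betw_pair_monomial, of m] by (simp add: card_pairs)

lemma card_quadrics_le:
  "finite (homogeneous m 2 :: 'k::{field,finite} mpoly set)"
  "card (homogeneous m 2 :: 'k mpoly set) \<le> CARD('k) ^ ((m + 2) choose 2)"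
proof -
  let ?E = "quadric_monomials m \<rightarrow>\<^sub>E (UNIV :: 'k set)"
  let ?h = "\<lambda>F :: 'k mpoly. restrict (Poly_Mapping.lookup F) (quadric_monomials m)"
  have inj: "inj_on ?h (homogeneous m 2)"
  proof (rule inj_onI)
    fix F G :: "'k mpoly"
    assume *: "F \<in> homogeneous m 2" "G \<in> homogeneous m 2" "?h F = ?h G"
    show "F = G"
    proof (rule poly_mapping_eqI)
      fix t
      show "Poly_Mapping.lookup F t = Poly_Mapping.lookup G t"
      proof (cases "t \<in> quadric_monomials m")
        case True
        then show ?thesis using fun_cong[OF *(3), of t] by simp
      next
        case False
        then have "t \<notin> Poly_Mapping.keys F" "t \<notin> Poly_Mapping.keys G"
          using *(1,2) by (auto simp: homogeneous_def quadric_monomials_def)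
        then show ?thesis by (simp add: in_keys_iff)
      qed
    qed
  qed
  have sub: "?h ` homogeneous m 2 \<subseteq> ?E" by auto
  have fin: "finite ?E" by (intro finite_PiE finite_quadric_monomials) simp
  show "finite (homogeneous m 2 :: 'k mpoly set)" by (rule inj_on_finite[OF inj sub fin])
  have "card (homogeneous m 2 :: 'k mpoly set) \<le> card ?E" by (rule card_inj_on_le[OF inj sub fin])
  also have "card ?E = CARD('k) ^ ((m + 2) choose 2)"
    by (simp add: card_PiE finite_quadric_monomials card_quadric_monomials)
  finally show "card (homogeneous m 2 :: 'k mpoly set) \<le> CARD('k) ^ ((m + 2) choose 2)" .
qed

lemma card_span_ge:
  fixes B :: "'k::{field,finite} mpoly set"
  assumes "finite B" "mpoly.independent B" "finite (mpoly.span B)"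
  shows "CARD('k) ^ card B \<le> card (mpoly.span B)"
proof -
  let ?c = "\<lambda>u. \<Sum>v\<in>B. mpoly_scale (u v) v"
  have "inj_on ?c (B \<rightarrow>\<^sub>E (UNIV :: 'k set))"
  proof (rule inj_onI)
    fix u w assume uw: "u \<in> B \<rightarrow>\<^sub>E (UNIV :: 'k set)" "w \<in> B \<rightarrow>\<^sub>E UNIV" "?c u = ?c w"
    have zero: "(\<Sum>v\<in>B. mpoly_scale (u v - w v) v) = 0"
      using uw(3) by (simp add: mpoly.scale_left_diff_distrib sum_subtractf)
    have "u v - w v = 0" if "v \<in> B" for v
      by (rule mpoly.independentD[OF assms(2,1) order_refl zero that])
    then show "u = w" using uw by (intro PiE_ext[OF uw(1,2)]) auto
  qed
  moreover have "?c u \<in> mpoly.span B" for u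
    by (intro mpoly.span_sum mpoly.span_scale mpoly.span_base)
  then have "?c ` (B \<rightarrow>\<^sub>E UNIV) \<subseteq> mpoly.span B" by blast
  ultimately have "card (B \<rightarrow>\<^sub>E (UNIV :: 'k set)) \<le> card (mpoly.span B)"
    using assms(3) by (rule card_inj_on_le)
  then show ?thesis using assms(1) by (simp add: card_PiE)
qed

definition quadric_funs :: "nat \<Rightarrow> ((nat \<Rightarrow> 'k::field) \<Rightarrow> 'k) set" where
  "quadric_funs m = (\<lambda>F a. mpoly_eval a F) ` homogeneous m 2"

definition linear_funs :: "nat \<Rightarrow> ((nat \<Rightarrow> 'k::field) \<Rightarrow> 'k) set" where
  "linear_funs m = range (\<lambda>c a. \<Sum>i\<le>m. c i * a i)"

lemma subspace_quadric_funs: "funs.subspace (quadric_funs m :: ((nat \<Rightarrow> 'k::field) \<Rightarrow> 'k) set)"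
proof (rule funs.subspaceI)
  have "(\<lambda>a. mpoly_eval a (0 :: 'k mpoly)) = 0" by (simp add: mpoly_eval_def fun_eq_iff)
  then show "0 \<in> (quadric_funs m :: ((nat \<Rightarrow> 'k) \<Rightarrow> 'k) set)"
    unfolding quadric_funs_def using mpoly.subspace_0[OF subspace_homogeneous] by (metis image_eqI)
next
  fix f g :: "(nat \<Rightarrow> 'k) \<Rightarrow> 'k" assume "f \<in> quadric_funs m" "g \<in> quadric_funs m"
  then obtain F G :: "'k mpoly" where FG: "F \<in> homogeneous m 2" "G \<in> homogeneous m 2"
    "f = (\<lambda>a. mpoly_eval a F)" "g = (\<lambda>a. mpoly_eval a G)" by (auto simp: quadric_funs_def)
  have "f + g = (\<lambda>a. mpoly_eval a (F + G))" by (simp add: FG mpoly_eval_add fun_eq_iff)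
  then show "f + g \<in> quadric_funs m"
    unfolding quadric_funs_def using mpoly.subspace_add[OF subspace_homogeneous FG(1,2)] by blast
next
  fix c and f :: "(nat \<Rightarrow> 'k) \<Rightarrow> 'k" assume "f \<in> quadric_funs m"
  then obtain F :: "'k mpoly" where F: "F \<in> homogeneous m 2" "f = (\<lambda>a. mpoly_eval a F)"
    by (auto simp: quadric_funs_def)
  have "fscale c f = (\<lambda>a. mpoly_eval a (mpoly_scale c F))"
    by (simp add: F mpoly_eval_scale fscale_def)
  then show "fscale c f \<in> quadric_funs m"
    unfolding quadric_funs_def using mpoly.subspace_scale[OF subspace_homogeneous F(1)] by blast
qed

lemma subspace_linear_funs: "funs.subspace (linear_funs m :: ((nat \<Rightarrow> 'k::field) \<Rightarrow> 'k) set)"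
proof (rule funs.subspaceI)
  have "(0 :: (nat \<Rightarrow> 'k) \<Rightarrow> 'k) = (\<lambda>a. \<Sum>i\<le>m. 0 * a i)" by (simp add: fun_eq_iff)
  then show "0 \<in> (linear_funs m :: ((nat \<Rightarrow> 'k) \<Rightarrow> 'k) set)"
    unfolding linear_funs_def by (rule range_eqI[of _ _ "\<lambda>_. 0"])
next
  fix f g :: "(nat \<Rightarrow> 'k) \<Rightarrow> 'k" assume "f \<in> linear_funs m" "g \<in> linear_funs m"
  then obtain c d where fg: "f = (\<lambda>a. \<Sum>i\<le>m. c i * a i)" "g = (\<lambda>a. \<Sum>i\<le>m. d i * a i)"
    by (auto simp: linear_funs_def)
  have "f + g = (\<lambda>a. \<Sum>i\<le>m. (c i + d i) * a i)"
    by (simp add: fg fun_eq_iff distrib_right sum.distrib)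
  then show "f + g \<in> linear_funs m"
    unfolding linear_funs_def by (rule range_eqI[of _ _ "\<lambda>i. c i + d i"])
next
  fix b and f :: "(nat \<Rightarrow> 'k) \<Rightarrow> 'k" assume "f \<in> linear_funs m"
  then obtain c where f: "f = (\<lambda>a. \<Sum>i\<le>m. c i * a i)" by (auto simp: linear_funs_def)
  have "fscale b f = (\<lambda>a. \<Sum>i\<le>m. (b * c i) * a i)"
    by (simp add: f fscale_def fun_eq_iff sum_distrib_left mult.assoc)
  then show "fscale b f \<in> linear_funs m"
    unfolding linear_funs_def by (rule range_eqI[of _ _ "\<lambda>i. b * c i"])
qed

lemma sum_fun_apply: "(\<Sum>i\<in>A. f i) x = (\<Sum>i\<in>A. f i x)"
  by (induction A rule: infinite_finite_induct) auto

lemma mult_linear_funs: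
  fixes f g :: "(nat \<Rightarrow> 'k::field) \<Rightarrow> 'k"
  assumes "f \<in> linear_funs m" "g \<in> linear_funs m"
  shows "f * g \<in> quadric_funs m"
proof -
  obtain c d where fg: "f = (\<lambda>a. \<Sum>i\<le>m. c i * a i)" "g = (\<lambda>a. \<Sum>i\<le>m. d i * a i)"
    using assms by (auto simp: linear_funs_def)
  have prod: "(\<lambda>a :: nat \<Rightarrow> 'k. a i * a j) \<in> quadric_funs m" if ij: "i \<le> m" "j \<le> m" for i j
  proof -
    let ?F = "Poly_Mapping.single (pair_monomial i j) (1 :: 'k)"
    have "pair_monomial i j \<in> quadric_monomials m"
    proof -
      have "pair_monomial i j = pair_monomial (min i j) (max i j)"
        using pair_monomial_commute[of i j] by (simp add: min_def max_def)
      moreover have "(min i j, max i j) \<in> pairs m" using ij by (simp add: pairs_def)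
      ultimately show ?thesis
        using bij_betw_imp_surj_on[OF bij_betw_pair_monomial, of m] by force
    qed
    then have hom: "?F \<in> homogeneous m 2"
      by (simp add: homogeneous_def quadric_monomials_def)
    have "mpoly_eval a ?F = a i * a j" for a
      using mpoly_eval_superset[of "{pair_monomial i j}" ?F a]
      by (simp add: mono_val_pair_monomial)
    then have "(\<lambda>a :: nat \<Rightarrow> 'k. a i * a j) = (\<lambda>a. mpoly_eval a ?F)" by simp
    then show ?thesis unfolding quadric_funs_def using hom by (rule image_eqI)
  qed
  have "f * g = (\<Sum>i\<le>m. \<Sum>j\<le>m. fscale (c i * d j) (\<lambda>a. a i * a j))"
    by (simp add: fg fun_eq_iff sum_fun_apply fscale_def sum_product algebra_simps)
  then show ?thesis
    using prod by (auto intro!: funs.subspace_sum[OF subspace_quadric_funs]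
        funs.subspace_scale[OF subspace_quadric_funs])
qed

text \<open>
  The span of \<open>B\<close> lies in the kernel of the evaluation of quadratic forms on \<open>X\<close>, and by independence
  its dimension is \<open>card B\<close>.
\<close>

lemma card_restr_quadric_funs_le:
  fixes B :: "'k::{field,finite} mpoly set"
  assumes B: "B \<subseteq> homogeneous m 2" "mpoly.independent B"
    and zero: "\<And>F a. F \<in> B \<Longrightarrow> a \<in> X \<Longrightarrow> mpoly_eval a F = 0"
  shows "card (restr X ` quadric_funs m) * CARD('k) ^ card B \<le> CARD('k) ^ ((m + 2) choose 2)"
proof -
  note H = card_quadrics_le[where 'k = 'k, of m]
  have span: "mpoly.span B \<subseteq> homogeneous m 2"
    by (rule mpoly.span_minimal[OF B(1) subspace_homogeneous])
  have span_zero: "mpoly_eval a G = 0" if "G \<in> mpoly.span B" "a \<in> X" for G a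
  proof -
    have "mpoly.subspace {G. mpoly_eval a G = 0}"
      by (rule mpoly.subspaceI) (auto simp: mpoly_eval_add mpoly_eval_scale mpoly_eval_def[of a 0])
    then have "mpoly.span B \<subseteq> {G. mpoly_eval a G = 0}"
      using zero that by (intro mpoly.span_minimal) auto
    then show ?thesis using that by blast
  qed
  let ?\<phi> = "\<lambda>F. restr X (\<lambda>a. mpoly_eval a F)"
  have "card (?\<phi> ` homogeneous m 2) * card (mpoly.span B) \<le> card (homogeneous m 2 :: 'k mpoly set)"
  proof (rule card_image_mult_le[OF H(1)])
    fix F G :: "'k mpoly" assume *: "F \<in> homogeneous m 2" "G \<in> mpoly.span B"
    have "F + G \<in> homogeneous m 2"
      using * span by (intro mpoly.subspace_add[OF subspace_homogeneous]) auto
    moreover have "?\<phi> (F + G) = ?\<phi> F"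
      using span_zero[OF *(2)] by (auto simp: restr_def fun_eq_iff mpoly_eval_add)
    ultimately show "F + G \<in> homogeneous m 2 \<and> ?\<phi> (F + G) = ?\<phi> F" ..
  qed
  moreover have "CARD('k) ^ card B \<le> card (mpoly.span B)"
    using B H(1) span by (intro card_span_ge) (auto intro: finite_subset)
  ultimately show ?thesis
    using H(2) by (simp add: quadric_funs_def image_image)
      (meson le_trans mult_le_mono2)
qed

section \<open>The bound in projective space\<close>

lemma separates_linear_funs:
  fixes X :: "(nat \<Rightarrow> 'k::field) set"
  assumes X: "X \<subseteq> nonzero_vecs m"
    and classes: "\<And>a b. a \<in> X \<Longrightarrow> b \<in> X \<Longrightarrow> (a, b) \<in> proportional m \<Longrightarrow> a = b"
  shows "separates (linear_funs m) X"
proof -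
  have coord: "(\<lambda>a. a i) \<in> (linear_funs m :: ((nat \<Rightarrow> 'k) \<Rightarrow> 'k) set)" if "i \<le> m" for i
  proof -
    have "(\<Sum>j\<le>m. of_bool (j = i) * a j) = a i" for a :: "nat \<Rightarrow> 'k"
    proof -
      have "(\<Sum>j\<le>m. of_bool (j = i) * a j) = (\<Sum>j\<le>m. if j = i then a j else 0)"
        by (intro sum.cong) auto
      then show ?thesis using that by simp
    qed
    then have "(\<lambda>a. a i) = (\<lambda>a :: nat \<Rightarrow> 'k. \<Sum>j\<le>m. of_bool (j = i) * a j)" by simp
    then show ?thesis
      unfolding linear_funs_def by (rule range_eqI[of _ _ "\<lambda>j. of_bool (j = i)"])
  qed
  have "\<exists>f\<in>linear_funs m. f a \<noteq> 0" if a: "a \<in> X" for a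
  proof -
    obtain i where "i \<le> m" "a i \<noteq> 0" using a X by (auto simp: nonzero_vecs_def)
    then show ?thesis using coord by (intro bexI[of _ "\<lambda>a. a i"])
  qed
  moreover have "\<exists>f\<in>linear_funs m. f a \<noteq> c * f b" if ab: "a \<in> X" "b \<in> X" "a \<noteq> b" for a b c
  proof (rule ccontr)
    assume "\<not> ?thesis"
    then have eq: "f a = c * f b" if "f \<in> linear_funs m" for f using that by blast
    have le: "a i = c * b i" if "i \<le> m" for i using eq[OF coord[OF that]] .
    have "a \<in> nonzero_vecs m" "b \<in> nonzero_vecs m" using X ab by auto
    then have "a i = c * b i" for i
      using le[of i] by (cases "i \<le> m") (auto simp: nonzero_vecs_def)
    then have a: "a = (\<lambda>i. c * b i)" by blast
    moreover have "c \<noteq> 0"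
    proof
      assume "c = 0"
      then have "\<forall>i. a i = 0" using a by simp
      then show False using X ab by (auto simp: nonzero_vecs_def)
    qed
    ultimately have "(b, a) \<in> proportional m" using X ab by (auto simp: proportional_def)
    then show False using classes ab by blast
  qed
  ultimately show ?thesis unfolding separates_def by blast
qed

lemma finite_proj_space: "finite (proj_space m :: (nat \<Rightarrow> 'k::{field,finite}) set set)"
  unfolding proj_space_def
  by (rule finite_quotient[OF card_nonzero_vecs(1)]) (auto simp: proportional_def)

text \<open>
  A set of representatives turns the points into vectors, on which linear and quadratic forms are honest
  functions.
\<close>

proposition card_proj_zeros_le:
  fixes B :: "'k::{field,finite} mpoly set"
  assumes B: "B \<subseteq> homogeneous m 2" "mpoly.independent B"
    and r: "(Suc K choose 2) + e + card B = (m + 2) choose 2" and e: "e \<le> K"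
  shows "card (proj_zeros m B) \<le> pts CARD('k) K + (if e = 0 then 0 else CARD('k) ^ (e - 1))"
proof -
  let ?V = "proj_zeros m B" and ?rep = "\<lambda>P :: (nat \<Rightarrow> 'k) set. SOME a. a \<in> P"
  have V: "?V \<subseteq> proj_space m" by (auto simp: proj_zeros_def)
  then have quot: "P \<in> nonzero_vecs m // proportional m" if "P \<in> ?V" for P
    using that by (auto simp: proj_space_def)
  have rep: "?rep P \<in> P" if "P \<in> ?V" for P
    using in_quotient_imp_non_empty[OF equiv_proportional quot[OF that]] by (simp add: some_in_eq)
  have eq: "P = P'" if "P \<in> ?V" "P' \<in> ?V" "(?rep P, ?rep P') \<in> proportional m" for P P'
    by (rule quotient_eqI[OF equiv_proportional quot quot rep rep]) (use that in auto)
  define X where "X = ?rep ` ?V"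
  have "X \<subseteq> nonzero_vecs m"
    using in_quotient_imp_subset[OF equiv_proportional quot] rep unfolding X_def by blast
  then have sep: "separates (linear_funs m) X"
    using eq unfolding X_def by (intro separates_linear_funs) auto
  have "finite ?V" using V finite_proj_space finite_subset by blast
  then have fin: "finite X" by (simp add: X_def)
  have "inj_on ?rep ?V"
  proof (rule inj_onI)
    fix P P' assume *: "P \<in> ?V" "P' \<in> ?V" "?rep P = ?rep P'"
    then have "?rep P \<in> nonzero_vecs m" using \<open>X \<subseteq> nonzero_vecs m\<close> by (auto simp: X_def)
    moreover have "refl_on (nonzero_vecs m) (proportional m :: ((nat \<Rightarrow> 'k) \<times> _) set)"
      by (rule equivE[OF equiv_proportional])
    ultimately have "(?rep P, ?rep P') \<in> proportional m"
      using * by (metis refl_onD)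
    then show "P = P'" using eq * by blast
  qed
  then have card: "card ?V = card X" by (simp add: X_def card_image)
  have "mpoly_eval a F = 0" if "F \<in> B" "a \<in> X" for F a
    using that rep unfolding X_def proj_zeros_def by blast
  from card_restr_quadric_funs_le[OF B this]
  have "card (restr X ` (quadric_funs m :: ((nat \<Rightarrow> 'k) \<Rightarrow> 'k) set)) * CARD('k) ^ card B
      \<le> CARD('k) ^ ((Suc K choose 2) + e) * CARD('k) ^ card B"
    unfolding r[symmetric] by (simp add: power_add)
  then have "card (restr X ` (quadric_funs m :: ((nat \<Rightarrow> 'k) \<Rightarrow> 'k) set)) \<le> CARD('k) ^ ((Suc K choose 2) + e)"
    by simp
  then have "card X \<le> pts CARD('k) K + (if e = 0 then 0 else CARD('k) ^ (e - 1))"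
    using mult_linear_funs fin sep e
    by (intro card_le_of_quadric_rank[OF subspace_linear_funs subspace_quadric_funs])
  then show ?thesis by (simp only: card)
qed

text \<open>
  Distinct monomials are independent. Without such a system the maximum would range over the empty set.
\<close>

lemma exists_independent_quadrics:
  assumes "r \<le> (m + 2) choose 2"
  shows "\<exists>Fs :: 'k::field mpoly list. length Fs = r \<and> set Fs \<subseteq> homogeneous m 2 \<and> distinct Fs \<and>
    mpoly.independent (set Fs)"
proof -
  obtain T where T: "T \<subseteq> quadric_monomials m" "card T = r"
    using assms card_quadric_monomials[of m] by (metis obtain_subset_with_card_n)
  have finT: "finite T" using T finite_quadric_monomials finite_subset by blast
  let ?s = "\<lambda>t. Poly_Mapping.single t (1 :: 'k)"
  have inj: "inj_on ?s T"
  proof (rule inj_onI)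
    fix t t' assume "?s t = ?s t'"
    then have "Poly_Mapping.keys (?s t) = Poly_Mapping.keys (?s t')" by simp
    then show "t = t'" by simp
  qed
  have "mpoly.independent (?s ` T)"
  proof
    assume "mpoly.dependent (?s ` T)"
    then obtain u t where u: "(\<Sum>v\<in>?s ` T. mpoly_scale (u v) v) = 0" "t \<in> T" "u (?s t) \<noteq> 0"
      using finT by (subst (asm) mpoly.dependent_finite) auto
    have "0 = Poly_Mapping.lookup (\<Sum>x\<in>T. mpoly_scale (u (?s x)) (?s x)) t"
      using u(1) inj by (simp add: sum.reindex)
    also have "\<dots> = (\<Sum>x\<in>T. u (?s x) * (1 when x = t))"
      by (simp add: lookup_sum lookup_mpoly_scale lookup_single)
    also have "\<dots> = u (?s t)" using finT u(2) by (simp add: when_def if_distrib cong: if_cong)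
    finally show False using u(3) by simp
  qed
  moreover obtain Fs where Fs: "set Fs = ?s ` T" "distinct Fs"
    using finite_distinct_list[OF finite_imageI[OF finT], of ?s] by blast
  moreover have "length Fs = r"
    using distinct_card[OF Fs(2)] card_image[OF inj] T(2) by (simp add: Fs(1))
  moreover have "?s ` T \<subseteq> homogeneous m 2"
    using T by (auto simp: homogeneous_def quadric_monomials_def)
  ultimately show ?thesis by (intro exI[of _ Fs]) simp
qed

lemma max_zeros_le:
  assumes r: "r \<le> (m + 2) choose 2"
    and le: "\<And>B :: 'k::{field,finite} mpoly set. B \<subseteq> homogeneous m 2 \<Longrightarrow> mpoly.independent B \<Longrightarrow>
      card B = r \<Longrightarrow> card (proj_zeros m B) \<le> b"
  shows "max_zeros TYPE('k) 2 m r \<le> b"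
proof -
  let ?A = "{card (proj_zeros m (set Fs)) | Fs :: 'k mpoly list.
     length Fs = r \<and> set Fs \<subseteq> homogeneous m 2 \<and> distinct Fs \<and> mpoly.independent (set Fs)}"
  have bound: "n \<le> b" if "n \<in> ?A" for n
    using that le distinct_card by auto
  then have "?A \<subseteq> {..b}" by blast
  then have "finite ?A" by (rule finite_subset) simp
  moreover have "?A \<noteq> {}" using exists_independent_quadrics[OF r] by blast
  ultimately show ?thesis unfolding max_zeros_def using bound by (intro Max.boundedI)
qed

section \<open>The lexicographic order\<close>

text \<open>
  The lists represent the elements \<open>e\<^sub>i + e\<^sub>j\<close> of \<open>\<Lambda>(2, m)\<close>, with \<open>i\<close> and \<open>j\<close> counted from \<open>0\<close>; hence
  for \<open>i \<le> j\<close> the first nonzero entry, in the numbering from \<open>1\<close>, is at \<open>Suc i\<close>.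
\<close>

definition exponent_list :: "nat \<Rightarrow> nat \<Rightarrow> nat \<Rightarrow> nat list" where
  "exponent_list m i j = map (pair_mult i j) [0..<Suc m]"

lemma length_exponent_list [simp]: "length (exponent_list m i j) = Suc m"
  by (simp add: exponent_list_def)

lemma nth_exponent_list [simp]: "k \<le> m \<Longrightarrow> exponent_list m i j ! k = pair_mult i j k"
  unfolding exponent_list_def by (subst nth_map) (simp_all del: upt_Suc)

lemma bij_betw_exponent_list:
  "bij_betw (\<lambda>(i, j). exponent_list m i j) (pairs m) (Lambda 2 m)"
proof (rule bij_betw_imageI)
  show "inj_on (\<lambda>(i, j). exponent_list m i j) (pairs m)"
  proof (rule inj_onI, clarify)
    fix i j i' j' assume *: "(i, j) \<in> pairs m" "(i', j') \<in> pairs m"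
      "exponent_list m i j = exponent_list m i' j'"
    have "pair_mult i j k = pair_mult i' j' k" if "k \<le> m" for k
      using *(3) nth_exponent_list that by metis
    then show "i = i' \<and> j = j'" using pair_mult_inj *(1,2) by blast
  qed
  have sum_nth: "sum_list \<nu> = (\<Sum>k\<le>m. \<nu> ! k)" if "length \<nu> = Suc m" for \<nu> :: "nat list"
    using that by (simp add: sum_list_sum_nth atLeast0LessThan lessThan_Suc_atMost)
  show "(\<lambda>(i, j). exponent_list m i j) ` pairs m = Lambda 2 m"
  proof (intro equalityI subsetI)
    fix \<nu> assume "\<nu> \<in> (\<lambda>(i, j). exponent_list m i j) ` pairs m"
    then show "\<nu> \<in> Lambda 2 m" by (auto simp: Lambda_def sum_nth sum_pair_mult)
  next
    fix \<nu> assume "\<nu> \<in> Lambda 2 m"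
    then have \<nu>: "length \<nu> = Suc m" "(\<Sum>k\<le>m. \<nu> ! k) = 2" using sum_nth by (auto simp: Lambda_def)
    from sum_eq_2_decomp[OF \<nu>(2)] obtain i j where ij: "(i, j) \<in> pairs m"
      "\<And>k. k \<le> m \<Longrightarrow> \<nu> ! k = pair_mult i j k" by metis
    then have "\<nu> = exponent_list m i j" using \<nu> by (intro nth_equalityI) auto
    then show "\<nu> \<in> (\<lambda>(i, j). exponent_list m i j) ` pairs m" using ij by auto
  qed
qed

lemma card_Lambda: "finite (Lambda 2 m)" "card (Lambda 2 m) = (m + 2) choose 2"
  using bij_betw_finite[OF bij_betw_exponent_list] finite_pairs
    bij_betw_same_card[OF bij_betw_exponent_list] by (auto simp: card_pairs)

lemma list_less_if_first_diff:
  fixes xs ys :: "nat list"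
  assumes "length xs = length ys" "k < length xs" "\<And>i. i < k \<Longrightarrow> xs ! i = ys ! i" "xs ! k < ys ! k"
  shows "xs < ys"
proof -
  have "take k xs = take k ys" using assms by (intro nth_take_lemma) auto
  then show ?thesis
    using assms unfolding list_less_def lexord_take_index_conv by auto
qed

text \<open>
  The earlier the units occur, the larger the list: the order of lists reverses the lexicographic order
  of index pairs.
\<close>

lemma exponent_list_less:
  assumes "(i, j) \<in> pairs m" "(i', j') \<in> pairs m" "i < i' \<or> i = i' \<and> j < j'"
  shows "exponent_list m i' j' < exponent_list m i j"
proof (cases "i < i'")
  case True
  then show ?thesis using assms
    by (intro list_less_if_first_diff[of _ _ i]) (auto simp: pairs_def pair_mult_def)
next
  case False
  then show ?thesis using assms
    by (intro list_less_if_first_diff[of _ _ j]) (auto simp: pairs_def pair_mult_def)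
qed

text \<open>
  The lists below have either the same \<open>i\<close> and a later second index (\<open>m - j\<close> of them), or both
  indices beyond \<open>i\<close>. The number has the form \<open>T K + e\<close> of the rank bound.
\<close>

lemma card_below_exponent_list:
  assumes ij: "(i, j) \<in> pairs m"
  shows "card {\<nu> \<in> Lambda 2 m. \<nu> < exponent_list m i j} = (Suc (m - i) choose 2) + (m - j)"
proof -
  let ?f = "\<lambda>(i, j). exponent_list m i j"
  let ?A = "{i} \<times> {Suc j..m}" and ?B = "{(a, b). Suc i \<le> a \<and> a \<le> b \<and> b \<le> m}"
  have "{\<nu> \<in> Lambda 2 m. \<nu> < exponent_list m i j} = ?f ` (?A \<union> ?B)"
  proof (intro equalityI subsetI)
    fix \<nu> assume \<nu>: "\<nu> \<in> {\<nu> \<in> Lambda 2 m. \<nu> < exponent_list m i j}"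
    then have "\<nu> \<in> ?f ` pairs m"
      using bij_betw_imp_surj_on[OF bij_betw_exponent_list, of m] by simp
    with \<nu> obtain a b where ab: "(a, b) \<in> pairs m" "\<nu> = exponent_list m a b"
      and less: "exponent_list m a b < exponent_list m i j"
      by auto
    have "i < a \<or> i = a \<and> j < b"
    proof (rule ccontr)
      assume "\<not> ?thesis"
      then have "(a, b) = (i, j) \<or> a < i \<or> a = i \<and> b < j" by auto
      then show False using less exponent_list_less[OF ab(1) ij] by fastforce
    qed
    then have "(a, b) \<in> ?A \<union> ?B" using ab by (auto simp: pairs_def)
    then show "\<nu> \<in> ?f ` (?A \<union> ?B)" using ab by force
  next
    fix \<nu> assume "\<nu> \<in> ?f ` (?A \<union> ?B)"
    then obtain a b where ab: "(a, b) \<in> ?A \<union> ?B" "\<nu> = exponent_list m a b" by fast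
    moreover have "(a, b) \<in> pairs m" using ab ij by (auto simp: pairs_def)
    ultimately show "\<nu> \<in> {\<nu> \<in> Lambda 2 m. \<nu> < exponent_list m i j}"
      using bij_betw_imp_surj_on[OF bij_betw_exponent_list, of m] exponent_list_less[OF ij, of a b]
      by force
  qed
  moreover have "inj_on ?f (?A \<union> ?B)"
    by (rule inj_on_subset[OF bij_betw_imp_inj_on[OF bij_betw_exponent_list]])
      (use ij in \<open>auto simp: pairs_def\<close>)
  moreover have "finite ?B" by (rule finite_subset[of _ "{..m} \<times> {..m}"]) auto
  ultimately have "card {\<nu> \<in> Lambda 2 m. \<nu> < exponent_list m i j} = card ?A + card ?B"
    by (subst card_Un_disjoint[symmetric]) (auto simp: card_image)
  then show ?thesis
    using ij card_pairs_from[of "Suc i" m] by (simp add: pairs_def card_cartesian_product)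
qed

lemma sorted_list_of_set_nth_card_below:
  assumes "finite A" "a \<in> A"
  shows "sorted_list_of_set A ! card {b \<in> A. b < a} = a"
proof -
  let ?xs = "sorted_list_of_set A"
  obtain k where k: "k < length ?xs" "?xs ! k = a"
    using assms by (metis in_set_conv_nth set_sorted_list_of_set)
  have mono: "?xs ! i < ?xs ! j" if "i < j" "j < length ?xs" for i j
    using that sorted_wrt_nth_less[OF strict_sorted_list_of_set] by blast
  have "{b \<in> A. b < a} = (!) ?xs ` {..<k}"
  proof (intro equalityI subsetI)
    fix b assume "b \<in> {b \<in> A. b < a}"
    then obtain i where i: "i < length ?xs" "?xs ! i = b" "b < a"
      using assms by (metis (no_types, lifting) in_set_conv_nth mem_Collect_eq set_sorted_list_of_set)
    have "i < k"
    proof (rule ccontr)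
      assume "\<not> i < k"
      then have "i = k \<or> k < i" by auto
      then show False using mono[of k i] i k by auto
    qed
    then show "b \<in> (!) ?xs ` {..<k}" using i by blast
  next
    fix b assume "b \<in> (!) ?xs ` {..<k}"
    then obtain i where i: "i < k" "b = ?xs ! i" by blast
    then have "b \<in> set ?xs" using k by simp
    then show "b \<in> {b \<in> A. b < a}" using i k mono[of i k] assms by simp
  qed
  moreover have "inj_on ((!) ?xs) {..<k}"
    using k by (intro inj_onI) (simp add: nth_eq_iff_index_eq)
  ultimately have "card {b \<in> A. b < a} = k" by (simp add: card_image)
  then show ?thesis using k by simp
qed

text \<open>
  Counting from the bottom is convenient because the \<open>r\<close>th element in descending order has
  \<open>\<delta> - r\<close> elements below it, where \<open>\<delta> = (m + 2) choose 2\<close>, and \<open>\<delta> - r\<close> is also the bound for the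
  rank of the quadratic forms on the common zeros of \<open>r\<close> independent quadrics.
\<close>

lemma nth_Lambda_exponent_list:
  assumes ij: "(i, j) \<in> pairs m" and r: "r \<ge> 1" "(Suc (m - i) choose 2) + (m - j) + r = (m + 2) choose 2"
  shows "nth_Lambda 2 m r = exponent_list m i j"
proof -
  let ?xs = "sorted_list_of_set (Lambda 2 m)"
  have len: "length ?xs = (m + 2) choose 2" using card_Lambda by simp
  have "exponent_list m i j \<in> Lambda 2 m"
    using bij_betw_imp_surj_on[OF bij_betw_exponent_list, of m] ij by force
  then have "?xs ! ((Suc (m - i) choose 2) + (m - j)) = exponent_list m i j"
    using sorted_list_of_set_nth_card_below[OF card_Lambda(1)] card_below_exponent_list[OF ij] by metis
  moreover have "nth_Lambda 2 m r = ?xs ! (length ?xs - Suc (r - 1))"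
    unfolding nth_Lambda_def using r len by (intro rev_nth) linarith
  moreover have "length ?xs - Suc (r - 1) = (Suc (m - i) choose 2) + (m - j)"
    using r len by linarith
  ultimately show ?thesis by simp
qed

lemma p_num_eq_pts: "p_num q (int n - 1) = int (pts q n)"
proof (cases n)
  case (Suc k)
  then show ?thesis by (simp add: p_num_def pts_def atLeast0AtMost lessThan_Suc_atMost)
qed (simp add: p_num_def)

lemma p_num_mono: "a \<le> b \<Longrightarrow> p_num q a \<le> p_num q b"
  unfolding p_num_def by (auto intro!: sum_mono2 sum_nonneg)

text \<open>
  The assumption \<open>j < m\<close> keeps both units inside the range of summation, which omits the last
  coordinate. For \<open>i = j\<close> the two summands coincide, in accordance with the entry \<open>2\<close>.
\<close>

lemma conjectured_max_exponent_list:
  assumes ij: "(i, j) \<in> pairs m" "j < m" and r: "nth_Lambda 2 m r = exponent_list m i j"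
  shows "conjectured_max q m r =
    p_num q (int m - int i - 1) + p_num q (int m - int j - 1) - p_num q (int m - int j - int i - 2)"
proof -
  let ?\<nu> = "exponent_list m i j"
  have c: "coord ?\<nu> k = of_bool (k = Suc i) + of_bool (k = Suc j)" if "k \<in> {1..Suc m}" for k
  proof -
    obtain l where "k = Suc l" using \<open>k \<in> {1..Suc m}\<close> by (cases k) auto
    then show ?thesis using that by (simp add: coord_def pair_mult_def)
  qed
  have "{k \<in> {1..length ?\<nu>}. coord ?\<nu> k \<noteq> 0} = {k \<in> {1..Suc m}. k = Suc i \<or> k = Suc j}"
    using c by auto
  also have "\<dots> = {Suc i, Suc j}" using ij by (auto simp: pairs_def)
  finally have first: "first_nonzero ?\<nu> = Suc i"
    using ij by (simp add: first_nonzero_def pairs_def)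
  have total: "(\<Sum>k=Suc i..m. int (coord ?\<nu> k) * g k) = g (Suc i) + g (Suc j)" for g :: "nat \<Rightarrow> int"
  proof -
    have "(\<Sum>k=Suc i..m. int (coord ?\<nu> k) * g k) =
        (\<Sum>k=Suc i..m. (if k = Suc i then g k else 0) + (if k = Suc j then g k else 0))"
      using c by (intro sum.cong) auto
    also have "\<dots> = g (Suc i) + g (Suc j)"
      using ij by (simp add: sum.distrib pairs_def)
    finally show ?thesis .
  qed
  show ?thesis
    unfolding conjectured_max_def r Let_def first total by (simp add: algebra_simps)
qed

section \<open>The conjectured maximum is too large\<close>

text \<open>
  The conjectured value retains at least the two highest powers of \<open>q\<close> in \<open>pts q (m - j)\<close> because
  \<open>i \<ge> 1\<close>, and both occur because \<open>m - j \<ge> 2\<close>; the bound on the maximum has only the highest one.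
\<close>

lemma max_zeros_less_conjectured_max:
  assumes ij: "1 \<le> i" "i \<le> j" "j + 2 \<le> m"
    and r: "r \<ge> 1" "(Suc (m - i) choose 2) + (m - j) + r = (m + 2) choose 2"
  shows "int (max_zeros TYPE('k::{field,finite}) 2 m r) < conjectured_max CARD('k) m r"
proof -
  let ?q = "CARD('k)"
  have pair: "(i, j) \<in> pairs m" using ij by (simp add: pairs_def)
  have "max_zeros TYPE('k) 2 m r \<le> pts ?q (m - i) + ?q ^ (m - j - 1)"
  proof (rule max_zeros_le)
    fix B :: "'k mpoly set"
    assume "B \<subseteq> homogeneous m 2" "mpoly.independent B" "card B = r"
    then show "card (proj_zeros m B) \<le> pts ?q (m - i) + ?q ^ (m - j - 1)"
      using card_proj_zeros_le[of B m "m - i" "m - j"] r ij by (simp split: if_splits)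
  qed (use r in linarith)
  then have max: "int (max_zeros TYPE('k) 2 m r) \<le> int (pts ?q (m - i)) + int (?q ^ (m - j - 1))"
    by linarith
  obtain n where n: "m - j = Suc (Suc n)" using ij by (intro that[of "m - j - 2"]) simp
  have "conjectured_max ?q m r =
      p_num ?q (int m - int i - 1) + p_num ?q (int m - int j - 1) - p_num ?q (int m - int j - int i - 2)"
    using ij by (intro conjectured_max_exponent_list[OF pair _ nth_Lambda_exponent_list[OF pair r]]) simp
  moreover have "p_num ?q (int m - int i - 1) = int (pts ?q (m - i))"
    using p_num_eq_pts[of ?q "m - i"] ij by (simp add: of_nat_diff)
  moreover have "p_num ?q (int m - int j - 1) = int (pts ?q (m - j))"
    using p_num_eq_pts[of ?q "m - j"] ij by (simp add: of_nat_diff)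
  moreover have "p_num ?q (int m - int j - int i - 2) \<le> p_num ?q (int n - 1)"
    using ij n by (intro p_num_mono) linarith
  moreover have "p_num ?q (int n - 1) = int (pts ?q n)" by (rule p_num_eq_pts)
  moreover have "int (pts ?q (m - j)) = int (pts ?q n) + int (?q ^ n) + int (?q ^ (m - j - 1))"
    by (simp add: n)
  moreover have "int (?q ^ n) > 0" by simp
  ultimately show ?thesis using max by linarith
qed

theorem corollary3p4:
  fixes q m :: nat
  assumes "primepow q" and "CARD('k::{field,finite}) = q" and "m > 2"
  defines "\<delta> \<equiv> (m + 2) choose 2"
  defines "equality \<equiv> \<lambda>r. int (max_zeros TYPE('k) 2 m r) = conjectured_max q m r"
  shows "\<not> (\<forall>r\<in>{1..\<delta>}. equality r) \<and>
         card {r. m + 1 < r \<and> r \<le> \<delta> \<and> \<not> equality r} \<ge> (m - 1) choose 2"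
proof -
  let ?S = "{(i, j). 1 \<le> i \<and> i \<le> j \<and> j \<le> m - 2}"
  let ?below = "\<lambda>i j. (Suc (m - i) choose 2) + (m - j)"
  let ?rank = "\<lambda>(i, j). \<delta> - ?below i j"
  let ?bad = "{r. m + 1 < r \<and> r \<le> \<delta> \<and> \<not> equality r}"
  \<comment> \<open>This bound is strong enough to give \<open>m + 1 < \<delta> - ?below i j\<close>: as \<open>i \<ge> 1\<close>, the \<open>m + 1\<close>
    elements of \<open>\<Lambda>(2, m)\<close> with nonzero first coordinate precede.\<close>
  have below: "?below i j + (m + 2) \<le> \<delta>" if "(i, j) \<in> ?S" for i j
  proof -
    have "Suc (m - i) choose 2 \<le> m choose 2"
      using that \<open>m > 2\<close> by (intro binomial_right_mono) auto
    moreover have "m - j \<le> m - 1" using that by auto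
    moreover have "\<delta> = (m choose 2) + m + (m + 1)"
      by (simp add: \<delta>_def numeral_2_eq_2)
    ultimately show ?thesis using \<open>m > 2\<close> by linarith
  qed
  have rank: "1 \<le> ?rank (i, j)" "?below i j + ?rank (i, j) = (m + 2) choose 2"
    if "(i, j) \<in> ?S" for i j
    using below[OF that] by (auto simp: \<delta>_def)
  have "?rank ` ?S \<subseteq> ?bad"
  proof clarify
    fix i j assume ij: "1 \<le> i" "i \<le> j" "j \<le> m - 2"
    then have S: "(i, j) \<in> ?S" by simp
    have "int (max_zeros TYPE('k) 2 m (?rank (i, j))) < conjectured_max CARD('k) m (?rank (i, j))"
      using ij \<open>m > 2\<close> by (intro max_zeros_less_conjectured_max[OF _ _ _ rank[OF S]]) auto
    then have "\<not> equality (\<delta> - ?below i j)" using assms(2) by (simp add: equality_def)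
    moreover have "m + 1 < \<delta> - ?below i j" using below[OF S] by linarith
    ultimately show "m + 1 < \<delta> - ?below i j \<and> \<delta> - ?below i j \<le> \<delta> \<and> \<not> equality (\<delta> - ?below i j)"
      by simp
  qed
  moreover have "inj_on ?rank ?S"
  proof (rule inj_onI)
    fix x y assume xy: "x \<in> ?S" "y \<in> ?S" "?rank x = ?rank y"
    obtain i j i' j' where ij: "x = (i, j)" "y = (i', j')" by fastforce
    have pairs: "(i, j) \<in> pairs m" "(i', j') \<in> pairs m" using xy ij by (auto simp: pairs_def)
    have "exponent_list m i j = nth_Lambda 2 m (?rank x)"
      using nth_Lambda_exponent_list[OF pairs(1) rank] xy(1) by (simp add: ij)
    also have "\<dots> = exponent_list m i' j'"
      using nth_Lambda_exponent_list[OF pairs(2) rank] xy(2) unfolding xy(3) by (simp add: ij)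
    finally have eq: "exponent_list m i j = exponent_list m i' j'" .
    have inj: "inj_on (\<lambda>(i, j). exponent_list m i j) (pairs m)"
      by (rule bij_betw_imp_inj_on[OF bij_betw_exponent_list])
    show "x = y" unfolding ij by (rule inj_onD[OF inj _ pairs]) (simp add: eq)
  qed
  moreover have fin: "finite ?bad" by (rule finite_subset[of _ "{..\<delta>}"]) auto
  ultimately have "card ?S \<le> card ?bad" using card_inj_on_le by blast
  moreover have "card ?S = (m - 1) choose 2"
    using card_pairs_from[of 1 "m - 2"] \<open>m > 2\<close> by (simp add: Suc_diff_Suc numeral_2_eq_2)
  ultimately have many: "(m - 1) choose 2 \<le> card ?bad" by simp
  have "0 < (m - 1) choose 2" using \<open>m > 2\<close> by (simp add: zero_less_binomial_iff)
  then have "0 < card ?bad" using many by linarith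
  then have "?bad \<noteq> {}" unfolding card_gt_0_iff ..
  then obtain r where "m + 1 < r" "r \<le> \<delta>" "\<not> equality r" by blast
  then have "\<not> (\<forall>r\<in>{1..\<delta>}. equality r)" by auto
  with many show ?thesis by blast
qed

end
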